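(* Let $m\in(0,1)$ and let $\Theta$ be a compact set in $\mathbb R$ with Minkowski dimension $\beta(\Theta)\in[0,1]$. If $s>\frac12-\frac m4+\frac{m\beta(\Theta)}{4}$, then for every $f\in H^s(\mathbb R)$ the pointwise convergence along the lines generated by $\Theta$, \[ \lim_{\substack{(y,t)\to(x,0)\\ y=x-\theta t,\ \theta\in\Theta}}e^{it(-\Delta)^{m/2}}f(y)=f(x), \] holds for almost every $x\in\mathbb R$.
   Context: $H^s(\mathbb R)$ is the inhomogeneous $L^2$-Sobolev space with norm $\|f\|_{H^s(\mathbb R)}=\|(1-\Delta)^{s/2}f\|_{L^2(\mathbb R)}$. With $\widehat f(\xi)=\int_{\mathbb R}e^{-ix\xi}f(x)\,dx$, one (formally) sets \[ e^{it(-\Delta)^{m/2}}f(x)=(2\pi)^{-1}\int_{\mathbb R}e^{i(x\xi+t|\xi|^m)}\widehat f(\xi)\,d\xi . \] For $f\in H^s(\mathbb R)$ the value at a given point $x$ and time $t$ is understood as $\lim_{N\to\infty}(2\pi)^{-1}\int_{\mathbb R}e^{i(x\xi+t|\xi|^m)}e^{-|\xi|^2/N^2}\widehat f(\xi)\,d\xi$ whenever this limit exists, and $f(x)$ denotes the value so obtained at $t=0$. The limit is taken as $(y,t)\to(x,0)$ over all points $(y,t)$ of the form $(x-\theta t,t)$ with $\theta\in\Theta$; that is, $\sup_{\theta\in\Theta}|e^{it(-\Delta)^{m/2}}f(x-\theta t)-f(x)|\to0$ as $t\to0$. *)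

theory Defs
  imports "HOL-Analysis.Analysis"
begin

definition L2 :: "(real \<Rightarrow> complex) set" where
  "L2 = {f \<in> borel_measurable lebesgue. integrable lebesgue (\<lambda>x. (cmod (f x))\<^sup>2)}"

text \<open>
  The Fourier transform on \<open>L\<^sup>2\<close>, as the \<open>L\<^sup>2\<close> limit of the truncated integrals of
  \<open>exp (- \<i> x \<xi>) f x\<close>. It is a relation because the transform is determined only up to null sets.
\<close>
definition has_fourier :: "(real \<Rightarrow> complex) \<Rightarrow> (real \<Rightarrow> complex) \<Rightarrow> bool" where
  "has_fourier f g \<longleftrightarrow> f \<in> L2 \<and> g \<in> L2 \<and>
     ((\<lambda>R. \<integral>\<^sup>+ \<xi>. ennreal ((cmod (g \<xi> - (LINT x:{-R..R}|lebesgue. cis (- (x * \<xi>)) * f x)))\<^sup>2)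
         \<partial>lebesgue) \<longlongrightarrow> 0) at_top"

definition fourier :: "(real \<Rightarrow> complex) \<Rightarrow> (real \<Rightarrow> complex)" where
  "fourier f = (SOME g. has_fourier f g)"

text \<open>
  The space \<open>H\<^sup>s\<close> for \<open>s \<ge> 0\<close>, where it is contained in \<open>L\<^sup>2\<close>. The function \<open>h\<close> is
  \<open>(1 - \<Delta>)\<close> to the power \<open>s / 2\<close> applied to \<open>f\<close>: the Fourier multiplier of \<open>1 - \<Delta>\<close> is \<open>1 + \<xi>\<^sup>2\<close>.
\<close>
definition sobolev :: "real \<Rightarrow> (real \<Rightarrow> complex) set" where
  "sobolev s = {f. \<exists>g h. has_fourier f g \<and>
     has_fourier h (\<lambda>\<xi>. of_real ((1 + \<xi>\<^sup>2) powr (s / 2)) * g \<xi>)}"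

definition propagator_mean ::
  "real \<Rightarrow> (real \<Rightarrow> complex) \<Rightarrow> real \<Rightarrow> real \<Rightarrow> real \<Rightarrow> complex" where
  "propagator_mean m f x t N = of_real (1 / (2 * pi)) *
     (LINT \<xi>|lebesgue. cis (x * \<xi> + t * \<bar>\<xi>\<bar> powr m) * of_real (exp (- (\<bar>\<xi>\<bar>\<^sup>2 / N\<^sup>2))) * fourier f \<xi>)"

text \<open>
  \<open>propagator m f x t\<close> is the value at \<open>(x, t)\<close> of the evolution with initial datum \<open>f\<close>; it is
  meaningful only where \<open>propagator_defined m f x t\<close> holds. The parameter \<open>N\<close> is real.
\<close>
definition propagator_defined ::
  "real \<Rightarrow> (real \<Rightarrow> complex) \<Rightarrow> real \<Rightarrow> real \<Rightarrow> bool" where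
  "propagator_defined m f x t \<longleftrightarrow> (\<exists>v. (propagator_mean m f x t \<longlongrightarrow> v) at_top)"

definition propagator :: "real \<Rightarrow> (real \<Rightarrow> complex) \<Rightarrow> real \<Rightarrow> real \<Rightarrow> complex" where
  "propagator m f x t = Lim at_top (propagator_mean m f x t)"

definition covering_number :: "real set \<Rightarrow> real \<Rightarrow> nat" where
  "covering_number A \<delta> = (LEAST n. \<exists>C. finite C \<and> card C = n \<and> A \<subseteq> (\<Union>c\<in>C. {c..c + \<delta>}))"

text \<open>
  This is the upper Minkowski dimension of a bounded set; it agrees with the Minkowski dimension
  whenever the upper and lower dimensions coincide.
\<close>
definition minkowski_dim :: "real set \<Rightarrow> real" where
  "minkowski_dim A =
     Inf {r. 0 < r \<and> ((\<lambda>\<delta>. real (covering_number A \<delta>) * \<delta> powr r) \<longlongrightarrow> 0) (at_right 0)}"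

end

theory Submission
  imports Defs
begin

text \<open>
  Cut the Fourier side into the annuli \<open>\<Lambda> \<le> \<bar>\<xi>\<bar> < 2 \<Lambda>\<close> with \<open>\<Lambda> = 2 ^ j\<close> and linearise the
  supremum over \<open>(\<theta>, t, N)\<close> of one piece by a measurable selection. If \<open>\<theta>\<close> stays in an interval of
  length \<open>\<delta> = \<Lambda> powr (- m / 2)\<close>, the kernel of \<open>T T\<^sup>*\<close> is
  \<open>O(\<Lambda> powr (1 - m / 2) * \<bar>x - x'\<bar> powr (- 1 / 2))\<close>, by van der Corput's lemma, for \<open>\<bar>x - x'\<bar> > 4 * \<delta>\<close>,
  and otherwise at most \<open>2 * \<Lambda>\<close> plus a term of that size; since \<open>\<Lambda> * \<delta> = \<Lambda> powr (1 - m / 2)\<close>,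
  both regions contribute equally.
  Covering \<open>\<Theta>\<close> by \<open>O(\<Lambda> powr (m * r / 2))\<close> such intervals, with \<open>r\<close> slightly larger than the
  dimension, the maximal function of the piece has local \<open>L\<^sup>1\<close> norm at most
  \<open>\<Lambda> powr (1/2 - m/4 + m * r / 4)\<close> times the \<open>L\<^sup>2\<close> norm of the piece, and this is summable in \<open>j\<close>
  for data in \<open>H\<^sup>s\<close>. So for almost every \<open>x\<close> the sum of the pieces converges uniformly
  on the compact set of parameters \<open>(\<theta>, t, 1 / N\<^sup>2)\<close>, and its sum is continuous there; continuity
  gives the limit \<open>N \<longlonglongrightarrow> \<infinity>\<close> as well as the limit \<open>t \<longlonglongrightarrow> 0\<close> uniformly in \<open>\<theta>\<close>.
\<close>

section \<open>Oscillatory integrals\<close>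

lemma borel_measurable_cis [measurable]: "cis \<in> borel_measurable borel"
  by (intro borel_measurable_continuous_onI continuous_on_cis continuous_on_id)

lemma borel_measurable_cnj [measurable]: "cnj \<in> borel_measurable borel"
  by (intro borel_measurable_continuous_onI continuous_intros)

lemma has_vector_derivative_cis:
  assumes "(f has_real_derivative f') (at x within S)"
  shows "((\<lambda>x. cis (f x)) has_vector_derivative (\<i> * of_real f' * cis (f x))) (at x within S)"
  using has_derivative_cis[OF assms[unfolded has_field_derivative_def]]
  by (simp add: has_vector_derivative_def scaleR_conv_of_real mult_ac)

text \<open>Integration by parts: \<open>F\<close> is an antiderivative up to the error
  \<open>E\<close>. The sign conditions on \<open>\<psi>'\<close> and \<open>\<phi>''\<close> make
  the majorant \<open>k\<close> of \<open>E\<close> an exact derivative, so its integral is read off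
  at the endpoints. The boundary values of \<open>F\<close> cost \<open>2 / \<rho>\<close> and the
  integral of \<open>k\<close> at most \<open>3 / \<rho>\<close>.\<close>

lemma van_der_corput_first:
  fixes \<phi> \<phi>' \<phi>'' \<psi> \<psi>' :: "real \<Rightarrow> real"
  assumes ab: "a \<le> b" and \<rho>: "0 < \<rho>"
    and d\<phi>: "\<And>x. x \<in> {a..b} \<Longrightarrow> (\<phi> has_real_derivative \<phi>' x) (at x within {a..b})"
    and d\<phi>': "\<And>x. x \<in> {a..b} \<Longrightarrow> (\<phi>' has_real_derivative \<phi>'' x) (at x within {a..b})"
    and d\<psi>: "\<And>x. x \<in> {a..b} \<Longrightarrow> (\<psi> has_real_derivative \<psi>' x) (at x within {a..b})"
    and big: "\<And>x. x \<in> {a..b} \<Longrightarrow> \<rho> \<le> \<bar>\<phi>' x\<bar>"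
    and convex: "\<And>x. x \<in> {a..b} \<Longrightarrow> 0 \<le> \<phi>'' x"
    and decr: "\<And>x. x \<in> {a..b} \<Longrightarrow> \<psi>' x \<le> 0"
    and \<psi>: "\<And>x. x \<in> {a..b} \<Longrightarrow> 0 \<le> \<psi> x" "\<And>x. x \<in> {a..b} \<Longrightarrow> \<psi> x \<le> 1"
  shows "cmod (integral {a..b} (\<lambda>x. cis (\<phi> x) * of_real (\<psi> x))) \<le> 5 / \<rho>"
proof -
  have nz: "\<phi>' x \<noteq> 0" if "x \<in> {a..b}" for x using big[OF that] \<rho> by auto
  have c\<phi>: "continuous_on {a..b} \<phi>" and c\<psi>: "continuous_on {a..b} \<psi>"
    by (auto intro!: DERIV_continuous_on d\<phi> d\<psi>)
  define F where "F x = - \<i> * cis (\<phi> x) * of_real (\<psi> x / \<phi>' x)" for x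
  define h where "h x = (\<psi>' x * \<phi>' x - \<psi> x * \<phi>'' x) / (\<phi>' x * \<phi>' x)" for x
  define E where "E x = - \<i> * cis (\<phi> x) * of_real (h x)" for x
  have dF: "(F has_vector_derivative (cis (\<phi> x) * of_real (\<psi> x) + E x)) (at x within {a..b})"
    if x: "x \<in> {a..b}" for x
  proof -
    have "((\<lambda>x. \<psi> x / \<phi>' x) has_real_derivative h x) (at x within {a..b})"
      unfolding h_def using DERIV_divide[OF d\<psi>[OF x] d\<phi>'[OF x] nz[OF x]] by (simp add: mult_ac)
    then have 1: "((\<lambda>x. of_real (\<psi> x / \<phi>' x) :: complex) has_vector_derivative of_real (h x)) (at x within {a..b})"
      by (intro has_vector_derivative_of_real) (simp add: has_real_derivative_iff_has_vector_derivative)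
    have "(F has_vector_derivative (- \<i> * cis (\<phi> x) * of_real (h x) +
        - \<i> * (\<i> * of_real (\<phi>' x) * cis (\<phi> x)) * of_real (\<psi> x / \<phi>' x))) (at x within {a..b})"
      unfolding F_def
      by (intro has_vector_derivative_mult has_vector_derivative_mult_right has_vector_derivative_cis d\<phi>[OF x] 1)
    then show ?thesis using nz[OF x] by (simp add: E_def add.commute mult.assoc[symmetric])
  qed
  have "((\<lambda>x. cis (\<phi> x) * of_real (\<psi> x) + E x) has_integral (F b - F a)) {a..b}"
    by (rule fundamental_theorem_of_calculus[OF ab dF])
  moreover have i1: "(\<lambda>x. cis (\<phi> x) * of_real (\<psi> x)) integrable_on {a..b}"
    by (intro integrable_continuous_real continuous_intros continuous_on_cis c\<phi> c\<psi>)
  ultimately have E: "(E has_integral (F b - F a - integral {a..b} (\<lambda>x. cis (\<phi> x) * of_real (\<psi> x)))) {a..b}"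
    using has_integral_diff[OF _ integrable_integral[OF i1]] by fastforce
  define k where "k x = - \<psi>' x / \<rho> + \<phi>'' x / (\<phi>' x * \<phi>' x)" for x
  have k: "(k has_integral (- \<psi> b / \<rho> - 1 / \<phi>' b) - (- \<psi> a / \<rho> - 1 / \<phi>' a)) {a..b}"
  proof (rule fundamental_theorem_of_calculus[OF ab])
    fix x assume x: "x \<in> {a..b}"
    have "((\<lambda>x. - \<psi> x / \<rho> - 1 / \<phi>' x) has_real_derivative k x) (at x within {a..b})"
      unfolding k_def using nz[OF x] \<rho>
      by (auto intro!: derivative_eq_intros d\<psi>[OF x] d\<phi>'[OF x])
    then show "((\<lambda>x. - \<psi> x / \<rho> - 1 / \<phi>' x) has_vector_derivative k x) (at x within {a..b})"
      by (simp add: has_real_derivative_iff_has_vector_derivative)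
  qed
  have Ek: "norm (E x) \<le> k x" if x: "x \<in> {a..b}" for x
  proof -
    have "h x = \<psi>' x / \<phi>' x - \<psi> x * \<phi>'' x / (\<phi>' x * \<phi>' x)"
      unfolding h_def using nz[OF x] by (simp add: field_simps)
    then have "\<bar>h x\<bar> \<le> \<bar>\<psi>' x / \<phi>' x\<bar> + \<bar>\<psi> x * \<phi>'' x / (\<phi>' x * \<phi>' x)\<bar>" by linarith
    also have "\<bar>\<psi>' x / \<phi>' x\<bar> \<le> - \<psi>' x / \<rho>"
      using frac_le[OF _ order.refl \<rho> big[OF x], of "- \<psi>' x"] decr[OF x] by (simp add: abs_divide)
    also have "\<bar>\<psi> x * \<phi>'' x / (\<phi>' x * \<phi>' x)\<bar> \<le> \<phi>'' x / (\<phi>' x * \<phi>' x)"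
      using convex[OF x] \<psi>[OF x] by (auto simp: abs_mult abs_divide intro!: divide_right_mono mult_left_le_one_le)
    finally show ?thesis by (simp add: k_def E_def norm_mult)
  qed
  have "norm (F b - F a - integral {a..b} (\<lambda>x. cis (\<phi> x) * of_real (\<psi> x)))
      \<le> (- \<psi> b / \<rho> - 1 / \<phi>' b) - (- \<psi> a / \<rho> - 1 / \<phi>' a)"
    using integral_norm_bound_integral[of E "{a..b}" k] E k Ek
    by (metis has_integral_integrable_integral integral_unique)
  moreover have Fb: "norm (F x) \<le> 1 / \<rho>" and inv: "\<bar>1 / \<phi>' x\<bar> \<le> 1 / \<rho>" if x: "x \<in> {a..b}" for x
  proof -
    show "\<bar>1 / \<phi>' x\<bar> \<le> 1 / \<rho>" using big[OF x] \<rho> by (auto simp: abs_divide intro!: divide_left_mono mult_pos_pos)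
    show "norm (F x) \<le> 1 / \<rho>"
      unfolding F_def using big[OF x] \<rho> \<psi>[OF x]
      by (auto simp: norm_mult norm_divide intro!: frac_le)
  qed
  moreover have "\<psi> a / \<rho> - \<psi> b / \<rho> \<le> 1 / \<rho>"
    using \<psi>[of a] \<psi>[of b] ab \<rho> by (auto simp flip: diff_divide_distrib intro!: divide_right_mono)
  moreover have "cmod (integral {a..b} (\<lambda>x. cis (\<phi> x) * of_real (\<psi> x))) \<le>
     norm (F b) + norm (F a) + norm (F b - F a - integral {a..b} (\<lambda>x. cis (\<phi> x) * of_real (\<psi> x)))"
    by norm
  ultimately have "cmod (integral {a..b} (\<lambda>x. cis (\<phi> x) * of_real (\<psi> x))) \<le> 5 * (1/\<rho>)"
    using inv[of a] inv[of b] Fb[of a] Fb[of b] ab unfolding abs_le_iff atLeastAtMost_iff by linarith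
  then show ?thesis by simp
qed

text \<open>As \<open>\<phi>'\<close> grows with slope at least \<open>\<rho>\<close>, it vanishes
  at most once. On either side of that point an interval of length \<open>1 / sqrt \<rho>\<close> is
  estimated trivially; beyond it \<open>\<bar>\<phi>'\<bar>\<close> is at least
  \<open>sqrt \<rho>\<close> and the first-derivative bound applies. Each side contributes
  \<open>(1 + 5) / sqrt \<rho>\<close>.\<close>

lemma van_der_corput_second:
  fixes \<phi> \<phi>' \<phi>'' \<psi> \<psi>' :: "real \<Rightarrow> real"
  assumes ab: "a \<le> b" and \<rho>: "0 < \<rho>"
    and d\<phi>: "\<And>x. x \<in> {a..b} \<Longrightarrow> (\<phi> has_real_derivative \<phi>' x) (at x within {a..b})"
    and d\<phi>': "\<And>x. x \<in> {a..b} \<Longrightarrow> (\<phi>' has_real_derivative \<phi>'' x) (at x within {a..b})"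
    and d\<psi>: "\<And>x. x \<in> {a..b} \<Longrightarrow> (\<psi> has_real_derivative \<psi>' x) (at x within {a..b})"
    and convex: "\<And>x. x \<in> {a..b} \<Longrightarrow> \<rho> \<le> \<phi>'' x"
    and decr: "\<And>x. x \<in> {a..b} \<Longrightarrow> \<psi>' x \<le> 0"
    and \<psi>: "\<And>x. x \<in> {a..b} \<Longrightarrow> 0 \<le> \<psi> x" "\<And>x. x \<in> {a..b} \<Longrightarrow> \<psi> x \<le> 1"
  shows "cmod (integral {a..b} (\<lambda>x. cis (\<phi> x) * of_real (\<psi> x))) \<le> 12 / sqrt \<rho>"
proof -
  let ?f = "\<lambda>x. cis (\<phi> x) * of_real (\<psi> x)"
  have cont: "continuous_on {a..b} ?f"
    by (intro continuous_intros continuous_on_cis DERIV_continuous_on[OF d\<phi>] DERIV_continuous_on[OF d\<psi>])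
  have int: "?f integrable_on {u..v}" if "a \<le> u" "v \<le> b" for u v
    by (rule integrable_continuous_real, rule continuous_on_subset[OF cont]) (use that in auto)
  have nb: "norm (?f x) \<le> 1" if "x \<in> {a..b}" for x
    using \<psi>[OF that] by (simp add: norm_mult)
  have short: "cmod (integral {u..v} ?f) \<le> v - u" if "a \<le> u" "u \<le> v" "v \<le> b" for u v
  proof -
    have "norm (integral {u..v} ?f) \<le> integral {u..v} (\<lambda>x. 1::real)"
      by (rule integral_norm_bound_integral[OF int]) (use that nb in auto)
    then show ?thesis using that by simp
  qed
  have long: "cmod (integral {u..v} ?f) \<le> 5 / \<sigma>"
    if "a \<le> u" "u \<le> v" "v \<le> b" "\<sigma> > 0" "\<And>x. x \<in> {u..v} \<Longrightarrow> \<sigma> \<le> \<bar>\<phi>' x\<bar>" for u v \<sigma>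
  proof (rule van_der_corput_first[of u v \<sigma> \<phi> \<phi>' \<phi>'' \<psi> \<psi>'])
    have s: "{u..v} \<subseteq> {a..b}" using that by auto
    fix x assume x: "x \<in> {u..v}"
    with s have xab: "x \<in> {a..b}" by auto
    show "(\<phi> has_real_derivative \<phi>' x) (at x within {u..v})" by (rule DERIV_subset[OF d\<phi>[OF xab] s])
    show "(\<phi>' has_real_derivative \<phi>'' x) (at x within {u..v})" by (rule DERIV_subset[OF d\<phi>'[OF xab] s])
    show "(\<psi> has_real_derivative \<psi>' x) (at x within {u..v})" by (rule DERIV_subset[OF d\<psi>[OF xab] s])
    show "0 \<le> \<phi>'' x" using convex[OF xab] \<rho> by linarith
    show "\<psi>' x \<le> 0" "0 \<le> \<psi> x" "\<psi> x \<le> 1" using decr[OF xab] \<psi>[OF xab] by auto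
    show "\<sigma> \<le> \<bar>\<phi>' x\<bar>" using that(5)[OF x] .
  qed (use that in auto)
  have grow: "\<rho> * (y - x) \<le> \<phi>' y - \<phi>' x" if "a \<le> x" "x \<le> y" "y \<le> b" for x y
  proof -
    have "(\<phi>'' has_integral \<phi>' y - \<phi>' x) {x..y}"
    proof (rule fundamental_theorem_of_calculus[OF \<open>x \<le> y\<close>])
      fix z assume "z \<in> {x..y}"
      with that have "z \<in> {a..b}" "{x..y} \<subseteq> {a..b}" by auto
      then show "(\<phi>' has_vector_derivative \<phi>'' z) (at z within {x..y})"
        using DERIV_subset[OF d\<phi>'] by (simp flip: has_real_derivative_iff_has_vector_derivative)
    qed
    moreover have "((\<lambda>_. \<rho>) has_integral \<rho> * (y - x)) {x..y}"
      using has_integral_const_real[of \<rho> x y] that by (simp add: mult.commute)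
    ultimately show ?thesis
      using has_integral_le[of "\<lambda>_. \<rho>" _ "{x..y}" \<phi>''] convex that by simp
  qed
  have mono: "\<phi>' x \<le> \<phi>' y" if "a \<le> x" "x \<le> y" "y \<le> b" for x y
    using grow[OF that] that \<rho> mult_nonneg_nonneg[of \<rho> "y - x"] by linarith
  \<comment> \<open>The splitting point is \<open>a\<close> if \<open>\<phi>'\<close> starts
    nonnegative, \<open>b\<close> if it ends nonpositive, and otherwise a zero of
    \<open>\<phi>'\<close>. The conditional sign facts cover all three cases, since one side
    degenerates in the first two.\<close>
  obtain c where c: "a \<le> c" "c \<le> b" "a < c \<Longrightarrow> \<phi>' c \<le> 0" "c < b \<Longrightarrow> 0 \<le> \<phi>' c"
  proof -
    consider "0 \<le> \<phi>' a" | "\<phi>' b \<le> 0" | "\<phi>' a \<le> 0" "0 \<le> \<phi>' b" by linarith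
    then show ?thesis
    proof cases
      case 3
      have "\<exists>x\<ge>a. x \<le> b \<and> \<phi>' x = 0"
        by (rule IVT') (use 3 ab DERIV_continuous_on[OF d\<phi>'] in auto)
      then show ?thesis using that by fastforce
    qed (use that[of a] that[of b] ab in auto)
  qed
  \<comment> \<open>This length balances the trivial bound \<open>d\<close> against
    \<open>5 / (\<rho> * d)\<close>, which equals \<open>5 * d\<close>.\<close>
  define d where "d = 1 / sqrt \<rho>"
  have d: "d > 0" "\<rho> * d = sqrt \<rho>" using \<rho> by (auto simp: d_def field_simps)
  have five: "5 / (\<rho> * d) = 5 * d" unfolding d(2) by (simp add: d_def)
  have right: "cmod (integral {c..b} ?f) \<le> 6 * d"
  proof (cases "c + d \<le> b")
    case True
    have "cmod (integral {c+d..b} ?f) \<le> 5 / (\<rho> * d)"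
    proof (rule long)
      fix x assume x: "x \<in> {c+d..b}"
      have "\<rho> * d \<le> \<rho> * (x - c)" using x \<rho> by auto
      also have "\<dots> \<le> \<phi>' x - \<phi>' c" by (rule grow) (use x c d in auto)
      also have "\<dots> \<le> \<bar>\<phi>' x\<bar>" using c True d by auto
      finally show "\<rho> * d \<le> \<bar>\<phi>' x\<bar>" .
    qed (use True c d \<rho> in auto)
    moreover have "cmod (integral {c..c+d} ?f) \<le> (c + d) - c" by (rule short) (use True c d in auto)
    moreover have "integral {c..c+d} ?f + integral {c+d..b} ?f = integral {c..b} ?f"
      by (rule Henstock_Kurzweil_Integration.integral_combine) (use True c d int in auto)
    ultimately show ?thesis using five norm_triangle_ineq[of "integral {c..c+d} ?f" "integral {c+d..b} ?f"] by simp
  next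
    case False
    then show ?thesis using short[of c b] c d by linarith
  qed
  have left: "cmod (integral {a..c} ?f) \<le> 6 * d"
  proof (cases "a \<le> c - d")
    case True
    have "cmod (integral {a..c-d} ?f) \<le> 5 / (\<rho> * d)"
    proof (rule long)
      fix x assume x: "x \<in> {a..c-d}"
      have "\<rho> * d \<le> \<rho> * (c - x)" using x \<rho> by auto
      also have "\<dots> \<le> \<phi>' c - \<phi>' x" by (rule grow) (use x c d in auto)
      also have "\<dots> \<le> \<bar>\<phi>' x\<bar>" using c True d by auto
      finally show "\<rho> * d \<le> \<bar>\<phi>' x\<bar>" .
    qed (use True c d \<rho> in auto)
    moreover have "cmod (integral {c-d..c} ?f) \<le> c - (c - d)" by (rule short) (use True c d in auto)
    moreover have "integral {a..c-d} ?f + integral {c-d..c} ?f = integral {a..c} ?f"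
      by (rule Henstock_Kurzweil_Integration.integral_combine) (use True c d int in auto)
    ultimately show ?thesis using five norm_triangle_ineq[of "integral {a..c-d} ?f" "integral {c-d..c} ?f"] by simp
  next
    case False
    then show ?thesis using short[of a c] c d by linarith
  qed
  have "integral {a..c} ?f + integral {c..b} ?f = integral {a..b} ?f"
    by (rule Henstock_Kurzweil_Integration.integral_combine) (use c int in auto)
  then have "cmod (integral {a..b} ?f) \<le> 12 * d"
    using left right norm_triangle_ineq[of "integral {a..c} ?f" "integral {c..b} ?f"] by simp
  then show ?thesis by (simp add: d_def)
qed

section \<open>The kernel of one dyadic frequency piece\<close>

context
  fixes m \<Lambda> \<nu> :: real
  assumes m: "0 < m" "m < 1" and \<Lambda>: "0 < \<Lambda>" and \<nu>: "0 \<le> \<nu>"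
begin

text \<open>Only positive frequencies enter, where \<open>\<xi> powr m\<close> is smooth.
  \<open>A\<close> is the displacement between two evaluation points, \<open>\<tau>\<close> their
  time difference, and \<open>\<nu>\<close> the sum of their Gaussian damping parameters.\<close>

definition half_kernel :: "real \<Rightarrow> real \<Rightarrow> complex" where
  "half_kernel A \<tau> = integral {\<Lambda>..2 * \<Lambda>} (\<lambda>\<xi>. cis (A * \<xi> + \<tau> * \<xi> powr m) * of_real (exp (- (\<nu> * \<xi>\<^sup>2))))"

lemma half_kernel_cont:
  "continuous_on {\<Lambda>..2 * \<Lambda>} (\<lambda>\<xi>. cis (A * \<xi> + \<tau> * \<xi> powr m) * of_real (exp (- (\<nu> * \<xi>\<^sup>2))))"
  using \<Lambda> by (intro continuous_intros continuous_on_cis) auto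

text \<open>Conjugation reverses the phase and fixes the real amplitude. It reduces the estimates
  below to \<open>\<tau> \<le> 0\<close>, where the phase is convex because
  \<open>m * (m - 1)\<close> is negative.\<close>

lemma half_kernel_uminus: "half_kernel (- A) (- \<tau>) = cnj (half_kernel A \<tau>)"
  unfolding half_kernel_def Henstock_Kurzweil_Integration.integral_cnj
  by (simp add: cis_cnj algebra_simps)

lemma half_kernel_trivial: "cmod (half_kernel A \<tau>) \<le> \<Lambda>"
proof -
  have "cmod (half_kernel A \<tau>) \<le> integral {\<Lambda>..2 * \<Lambda>} (\<lambda>\<xi>. 1::real)"
    unfolding half_kernel_def using \<nu>
    by (intro integral_norm_bound_integral integrable_continuous_real half_kernel_cont)
       (auto simp: norm_mult)
  then show ?thesis using \<Lambda> by simp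
qed

lemma half_kernel_derivs:
  assumes "\<xi> \<in> {\<Lambda>..2 * \<Lambda>}"
  shows "((\<lambda>\<xi>. A * \<xi> + \<tau> * \<xi> powr m) has_real_derivative A + \<tau> * (m * \<xi> powr (m - 1))) (at \<xi> within S)"
    and "((\<lambda>\<xi>. A + \<tau> * (m * \<xi> powr (m - 1))) has_real_derivative \<tau> * (m * ((m - 1) * \<xi> powr (m - 2)))) (at \<xi> within S)"
    and "((\<lambda>\<xi>. exp (- (\<nu> * \<xi>\<^sup>2))) has_real_derivative - (2 * \<nu> * \<xi> * exp (- (\<nu> * \<xi>\<^sup>2)))) (at \<xi> within S)"
proof -
  have "\<xi> > 0" using assms \<Lambda> by auto
  then show "((\<lambda>\<xi>. A * \<xi> + \<tau> * \<xi> powr m) has_real_derivative A + \<tau> * (m * \<xi> powr (m - 1))) (at \<xi> within S)"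
    and "((\<lambda>\<xi>. A + \<tau> * (m * \<xi> powr (m - 1))) has_real_derivative \<tau> * (m * ((m - 1) * \<xi> powr (m - 2)))) (at \<xi> within S)"
    by (auto intro!: derivative_eq_intros)
  show "((\<lambda>\<xi>. exp (- (\<nu> * \<xi>\<^sup>2))) has_real_derivative - (2 * \<nu> * \<xi> * exp (- (\<nu> * \<xi>\<^sup>2)))) (at \<xi> within S)"
    by (auto intro!: derivative_eq_intros)
qed

text \<open>For negative \<open>\<tau>\<close> the second derivative of the phase is positive and
  decreasing in \<open>\<xi>\<close>, so its minimum is attained at \<open>2 * \<Lambda>\<close>.
  The Gaussian factor serves as the decreasing amplitude of van der Corput's lemma.\<close>

lemma half_kernel_second:
  assumes "\<tau> \<noteq> 0"
  shows "cmod (half_kernel A \<tau>) \<le> 12 / sqrt (\<bar>\<tau>\<bar> * (m * (1 - m)) * (2 * \<Lambda>) powr (m - 2))"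
proof -
  have *: "cmod (half_kernel A \<tau>) \<le> 12 / sqrt (- \<tau> * (m * (1 - m)) * (2 * \<Lambda>) powr (m - 2))" if "\<tau> < 0" for A \<tau>
    unfolding half_kernel_def
  proof (rule van_der_corput_second[OF _ _ half_kernel_derivs])
    show "0 < - \<tau> * (m * (1 - m)) * (2 * \<Lambda>) powr (m - 2)"
      using that m \<Lambda> by (intro mult_pos_pos) auto
    fix \<xi> assume \<xi>: "\<xi> \<in> {\<Lambda>..2 * \<Lambda>}"
    then have "(2 * \<Lambda>) powr (m - 2) \<le> \<xi> powr (m - 2)" using m \<Lambda> by (intro powr_mono2') auto
    then have "- \<tau> * (m * (1 - m)) * (2 * \<Lambda>) powr (m - 2) \<le> - \<tau> * (m * (1 - m)) * \<xi> powr (m - 2)"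
      using that m by (intro mult_left_mono) (auto simp: mult_nonpos_nonneg)
    then show "- \<tau> * (m * (1 - m)) * (2 * \<Lambda>) powr (m - 2) \<le> \<tau> * (m * ((m - 1) * \<xi> powr (m - 2)))"
      by (simp add: algebra_simps)
    show "- (2 * \<nu> * \<xi> * exp (- (\<nu> * \<xi>\<^sup>2))) \<le> 0" using \<xi> \<Lambda> \<nu> by simp
  qed (use \<Lambda> \<nu> in auto)
  show ?thesis
  proof (cases "\<tau> < 0")
    case True then show ?thesis using *[of \<tau> A] by simp
  next
    case False
    then show ?thesis using *[of "- \<tau>" "- A"] assms half_kernel_uminus[of A \<tau>] by simp
  qed
qed

text \<open>On the interval \<open>m * \<xi> powr (m - 1)\<close> is at most
  \<open>\<Lambda> powr (m - 1)\<close>, so the hypothesis confines the derivative of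
  \<open>\<tau> * \<xi> powr m\<close> to \<open>\<bar>A\<bar> / 2\<close>. There is then no
  stationary point, and the derivative of the phase is at least \<open>\<bar>A\<bar> / 2\<close> in
  absolute value.\<close>

lemma half_kernel_first:
  assumes "A \<noteq> 0" "2 * \<bar>\<tau>\<bar> * \<Lambda> powr (m - 1) \<le> \<bar>A\<bar>"
  shows "cmod (half_kernel A \<tau>) \<le> 10 / \<bar>A\<bar>"
proof -
  have *: "cmod (half_kernel A \<tau>) \<le> 5 / (\<bar>A\<bar> / 2)"
    if "\<tau> \<le> 0" and A: "A \<noteq> 0" "2 * \<bar>\<tau>\<bar> * \<Lambda> powr (m - 1) \<le> \<bar>A\<bar>" for A \<tau>
    unfolding half_kernel_def
  proof (rule van_der_corput_first[OF _ _ half_kernel_derivs])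
    show "0 < \<bar>A\<bar> / 2" using A by simp
    fix \<xi> assume \<xi>: "\<xi> \<in> {\<Lambda>..2 * \<Lambda>}"
    then have "\<xi> powr (m - 1) \<le> \<Lambda> powr (m - 1)" using m \<Lambda> by (intro powr_mono2') auto
    then have "m * \<xi> powr (m - 1) \<le> 1 * \<Lambda> powr (m - 1)" using m by (intro mult_mono) auto
    then have "\<bar>\<tau>\<bar> * (m * \<xi> powr (m - 1)) \<le> \<bar>\<tau>\<bar> * \<Lambda> powr (m - 1)" by (intro mult_left_mono) auto
    then have "\<bar>\<tau> * (m * \<xi> powr (m - 1))\<bar> \<le> \<bar>A\<bar> / 2" using A m by (simp add: abs_mult)
    then show "\<bar>A\<bar> / 2 \<le> \<bar>A + \<tau> * (m * \<xi> powr (m - 1))\<bar>" by linarith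
    have "0 \<le> - \<tau> * (m * ((1 - m) * \<xi> powr (m - 2)))"
      using that m by (intro mult_nonneg_nonneg) auto
    then show "0 \<le> \<tau> * (m * ((m - 1) * \<xi> powr (m - 2)))" by (simp add: algebra_simps)
    show "- (2 * \<nu> * \<xi> * exp (- (\<nu> * \<xi>\<^sup>2))) \<le> 0" using \<xi> \<Lambda> \<nu> by simp
  qed (use \<Lambda> \<nu> in auto)
  show ?thesis
  proof (cases "\<tau> \<le> 0")
    case True then show ?thesis using *[of \<tau> A] assms by simp
  next
    case False
    then show ?thesis using *[of "- \<tau>" "- A"] assms half_kernel_uminus[of A \<tau>] by simp
  qed
qed

text \<open>The kernel of \<open>T T\<^sup>*\<close> for one annulus, with the parameters of the two
  points already combined into \<open>A\<close>, \<open>\<tau>\<close> and \<open>\<nu>\<close>. The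
  annulus is half open so that consecutive dyadic annuli are disjoint.\<close>

definition dyadic_kernel :: "real \<Rightarrow> real \<Rightarrow> complex" where
  "dyadic_kernel A \<tau> = (LINT \<xi>:{\<xi>. \<Lambda> \<le> \<bar>\<xi>\<bar> \<and> \<bar>\<xi>\<bar> < 2 * \<Lambda>}|lborel.
     cis (A * \<xi> + \<tau> * \<bar>\<xi>\<bar> powr m) * of_real (exp (- (\<nu> * \<xi>\<^sup>2))))"

text \<open>The reflection of \<open>\<xi>\<close> maps the negative half of the annulus to the
  positive one and turns \<open>A\<close> into \<open>- A\<close>, everything else being even. The
  endpoint at which half-open and closed intervals differ is a null set.\<close>

lemma dyadic_kernel_eq: "dyadic_kernel A \<tau> = half_kernel A \<tau> + half_kernel (- A) \<tau>"
proof -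
  define f where "f A \<xi> = cis (A * \<xi> + \<tau> * \<bar>\<xi>\<bar> powr m) * of_real (exp (- (\<nu> * \<xi>\<^sup>2)))" for A \<xi>
  have [measurable]: "f A \<in> borel_measurable borel" for A unfolding f_def by measurable
  have nf: "norm (f A \<xi>) \<le> 1" for A \<xi> using \<nu> by (simp add: f_def norm_mult)
  have int: "set_integrable lborel {u..v} (f A)" for u v A
    unfolding set_integrable_def
    by (rule Bochner_Integration.integrable_bound[of _ "indicat_real {u..v}"])
       (use nf in \<open>auto simp: indicator_def integrable_real_indicator emeasure_lborel_Icc_eq\<close>)
  have half: "(LINT \<xi>:{\<Lambda>..<2 * \<Lambda>}|lborel. f A \<xi>) = half_kernel A \<tau>" for A
  proof -
    have "(LINT \<xi>:{\<Lambda>..<2 * \<Lambda>}|lborel. f A \<xi>) = (LINT \<xi>:{\<Lambda>..2 * \<Lambda>}|lborel. f A \<xi>)"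
      unfolding set_lebesgue_integral_def
      by (rule integral_cong_AE)
         (use AE_lborel_singleton[of "2 * \<Lambda>"] in \<open>auto elim!: eventually_mono simp: indicator_def\<close>)
    also have "\<dots> = integral {\<Lambda>..2 * \<Lambda>} (f A)" by (rule set_borel_integral_eq_integral(2)[OF int])
    also have "\<dots> = half_kernel A \<tau>" unfolding half_kernel_def f_def
      by (rule Henstock_Kurzweil_Integration.integral_cong) (use \<Lambda> in auto)
    finally show ?thesis .
  qed
  have "dyadic_kernel A \<tau> = (LINT \<xi>:{\<Lambda>..<2 * \<Lambda>} \<union> {- 2 * \<Lambda><..- \<Lambda>}|lborel. f A \<xi>)"
    unfolding dyadic_kernel_def f_def
    by (rule arg_cong[where f="\<lambda>S. set_lebesgue_integral lborel S _"]) (use \<Lambda> in auto)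
  also have "\<dots> = (LINT \<xi>:{\<Lambda>..<2 * \<Lambda>}|lborel. f A \<xi>) + (LINT \<xi>:{- 2 * \<Lambda><..- \<Lambda>}|lborel. f A \<xi>)"
    by (rule set_integral_Un)
       (use \<Lambda> in \<open>auto intro: set_integrable_subset[OF int[of \<Lambda> "2*\<Lambda>"]] set_integrable_subset[OF int[of "-2*\<Lambda>" "-\<Lambda>"]]\<close>)
  also have "(LINT \<xi>:{- 2 * \<Lambda><..- \<Lambda>}|lborel. f A \<xi>) = (LINT \<xi>:{\<Lambda>..<2 * \<Lambda>}|lborel. f (- A) \<xi>)"
    unfolding set_lebesgue_integral_def
    by (subst lborel_integral_real_affine[of "-1" _ 0])
       (auto intro!: Bochner_Integration.integral_cong simp: f_def indicator_def)
  finally show ?thesis by (simp add: half)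
qed

end

text \<open>
  With \<open>D = \<bar>x - x'\<bar>\<close>: if \<open>t - t'\<close> is at least comparable to \<open>D\<close>, the second derivative
  of the phase is large; if it is smaller and \<open>D > 4 * \<delta>\<close>, the linear term dominates and the first
  derivative is large; otherwise the trivial bound is used.
\<close>
lemma dyadic_kernel_bound:
  fixes m \<Lambda> \<nu> M \<theta> \<theta>' t t' x x' :: real
  defines "\<delta> \<equiv> \<Lambda> powr (- m / 2)"
  assumes m: "0 < m" "m < 1" and \<Lambda>: "1 \<le> \<Lambda>" and \<nu>: "0 \<le> \<nu>"
    and \<theta>: "\<bar>\<theta>\<bar> \<le> M" "\<bar>\<theta> - \<theta>'\<bar> \<le> \<delta>" and t: "\<bar>t\<bar> \<le> 1" "\<bar>t'\<bar> \<le> 1"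
  shows "cmod (dyadic_kernel m \<Lambda> \<nu> (x - x' - \<theta> * t + \<theta>' * t') (t - t'))
    \<le> (48 / sqrt (m * (1 - m) / (4 * (M + 1))) + 20) * \<Lambda> powr (1 - m / 2) * (1 / sqrt \<bar>x - x'\<bar>)
      + 2 * \<Lambda> * indicator {- 4 * \<delta>..4 * \<delta>} (x - x')"
proof -
  define A where "A = x - x' - \<theta> * t + \<theta>' * t'"
  define D where "D = \<bar>x - x'\<bar>"
  define c where "c = m * (1 - m) / (4 * (M + 1))"
  have \<Lambda>0: "0 < \<Lambda>" using \<Lambda> by simp
  have M: "0 \<le> M" using \<theta> by linarith
  have c: "c > 0" using m M by (simp add: c_def)
  have \<delta>0: "\<delta> > 0" using \<Lambda> by (simp add: \<delta>_def)
  note eq = dyadic_kernel_eq[OF m \<Lambda>0 \<nu>]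
  have two: "cmod (dyadic_kernel m \<Lambda> \<nu> A (t - t')) \<le> 2 * B"
    if "\<And>A'. A' = A \<or> A' = - A \<Longrightarrow> cmod (half_kernel m \<Lambda> \<nu> A' (t - t')) \<le> B" for B
    unfolding eq using norm_triangle_ineq[of "half_kernel m \<Lambda> \<nu> A (t - t')" "half_kernel m \<Lambda> \<nu> (- A) (t - t')"]
      that[of A] that[of "-A"] by simp
  consider "D \<le> 4 * \<delta>" | "4 * \<delta> < D" "D / (4 * (M + 1)) \<le> \<bar>t - t'\<bar>"
    | "4 * \<delta> < D" "\<bar>t - t'\<bar> < D / (4 * (M + 1))" by linarith
  then have "cmod (dyadic_kernel m \<Lambda> \<nu> A (t - t'))
    \<le> (48 / sqrt c + 20) * \<Lambda> powr (1 - m / 2) * (1 / sqrt D)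
      + 2 * \<Lambda> * indicator {- 4 * \<delta>..4 * \<delta>} (x - x')"
  proof cases
    case 1
    then have "indicator {- 4 * \<delta>..4 * \<delta>} (x - x') = (1::real)" by (auto simp: D_def indicator_def abs_le_iff)
    moreover have "cmod (dyadic_kernel m \<Lambda> \<nu> A (t - t')) \<le> 2 * \<Lambda>"
      by (rule two) (rule half_kernel_trivial[OF m \<Lambda>0 \<nu>])
    moreover have "0 \<le> (48 / sqrt c + 20) * \<Lambda> powr (1 - m / 2) * (1 / sqrt D)"
      using c by (simp add: D_def)
    ultimately show ?thesis by simp
  next
    case 2
    then have D: "D > 0" using \<delta>0 by linarith
    have tt: "t - t' \<noteq> 0" using 2 D M by (auto simp: divide_le_0_iff)
    \<comment> \<open>The reciprocal square root of \<open>(2 * \<Lambda>) powr (m - 2)\<close>, a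
      factor under the root in the second-derivative bound.\<close>
    define q where "q = (2 * \<Lambda>) powr (1 - m / 2)"
    have q: "q > 0" using \<Lambda>0 by (simp add: q_def)
    have "(2 * \<Lambda>) powr (m - 2) = 1 / q\<^sup>2"
      using \<Lambda>0 unfolding q_def power2_eq_square by (simp add: powr_minus_divide powr_add[symmetric] field_simps flip: powr_minus)
    then have le: "c * D / q\<^sup>2 \<le> \<bar>t - t'\<bar> * (m * (1 - m)) * (2 * \<Lambda>) powr (m - 2)"
      using mult_right_mono[OF 2(2), of "m * (1 - m) / q\<^sup>2"] m by (simp add: c_def mult_ac)
    have "cmod (dyadic_kernel m \<Lambda> \<nu> A (t - t')) \<le> 2 * (12 / sqrt (\<bar>t - t'\<bar> * (m * (1 - m)) * (2 * \<Lambda>) powr (m - 2)))"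
      by (rule two) (rule half_kernel_second[OF m \<Lambda>0 \<nu> tt])
    also have "\<dots> \<le> 2 * (12 / sqrt (c * D / q\<^sup>2))"
      using le c D q by (intro mult_left_mono divide_left_mono mult_pos_pos real_sqrt_le_mono) (auto intro: less_le_trans[OF _ le])
    also have "\<dots> = 24 / sqrt c * q * (1 / sqrt D)"
      using c D q by (simp add: real_sqrt_mult real_sqrt_divide field_simps)
    also have "\<dots> \<le> 24 / sqrt c * (2 * \<Lambda> powr (1 - m / 2)) * (1 / sqrt D)"
    proof -
      have "q = 2 powr (1 - m / 2) * \<Lambda> powr (1 - m / 2)" using \<Lambda>0 by (simp add: q_def powr_mult)
      also have "\<dots> \<le> 2 * \<Lambda> powr (1 - m / 2)"
        using powr_mono[of "1 - m / 2" 1 "2::real"] m by (intro mult_right_mono) auto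
      finally show ?thesis using c D by (intro mult_right_mono mult_left_mono) auto
    qed
    also have "\<dots> \<le> (48 / sqrt c + 20) * \<Lambda> powr (1 - m / 2) * (1 / sqrt D)"
      using c D by (simp add: algebra_simps)
    finally show ?thesis using \<Lambda>0 by (smt (verit) indicator_pos_le mult_nonneg_nonneg)
  next
    case 3
    then have D: "D > 0" using \<delta>0 by linarith
    have h: "\<bar>t - t'\<bar> * (4 * (M + 1)) < D" using 3(2) M by (simp add: pos_less_divide_eq)
    \<comment> \<open>The displacement is
      \<open>(x - x') - \<theta> * (t - t') - (\<theta> - \<theta>') * t'\<close>. The middle term
      is at most \<open>D / 4\<close> because the times are close, the last one is below
      \<open>D / 4\<close> because \<open>\<theta>\<close> and \<open>\<theta>'\<close> differ by at
      most \<open>\<delta>\<close>. Hence \<open>D / 2\<close> is left.\<close>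
    have "\<bar>A\<bar> \<ge> D - \<bar>\<theta> * (t - t')\<bar> - \<bar>(\<theta> - \<theta>') * t'\<bar>"
      unfolding A_def D_def by (simp add: algebra_simps)
    moreover have "\<bar>\<theta> * (t - t')\<bar> \<le> M * \<bar>t - t'\<bar>" using \<theta> by (auto simp: abs_mult intro: mult_right_mono)
    moreover have "\<bar>(\<theta> - \<theta>') * t'\<bar> \<le> \<delta> * 1" unfolding abs_mult using \<theta> t \<delta>0 by (intro mult_mono) auto
    moreover have "M * \<bar>t - t'\<bar> * 4 \<le> D" using h by (simp add: algebra_simps) (smt (verit) abs_ge_zero)
    ultimately have A: "D / 2 \<le> \<bar>A\<bar>" using 3(1) by linarith
    have "\<Lambda> powr (m - 1) \<le> \<Lambda> powr 0" using m \<Lambda> by (intro powr_mono) auto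
    then have "2 * \<bar>t - t'\<bar> * \<Lambda> powr (m - 1) \<le> 2 * \<bar>t - t'\<bar> * 1" using \<Lambda>0 by (intro mult_left_mono) auto
    also have "\<dots> \<le> D / 2"
    proof -
      have "\<bar>t - t'\<bar> * 4 \<le> \<bar>t - t'\<bar> * (4 * (M + 1))" using M by (intro mult_left_mono) auto
      then show ?thesis using h by linarith
    qed
    finally have A2: "2 * \<bar>t - t'\<bar> * \<Lambda> powr (m - 1) \<le> \<bar>A\<bar>" using A by linarith
    have "cmod (dyadic_kernel m \<Lambda> \<nu> A (t - t')) \<le> 2 * (10 / \<bar>A\<bar>)"
    proof (rule two)
      fix A' assume "A' = A \<or> A' = - A"
      then show "cmod (half_kernel m \<Lambda> \<nu> A' (t - t')) \<le> 10 / \<bar>A\<bar>"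
        using half_kernel_first[OF m \<Lambda>0 \<nu>, of A' "t - t'"] A A2 D by auto
    qed
    also have "\<dots> \<le> 2 * (10 / (D / 2))" using A D by (intro mult_left_mono divide_left_mono) auto
    also have "\<dots> = 40 * (1 / sqrt D) * (1 / sqrt D)"
      using D by (simp add: field_simps)
    \<comment> \<open>Since \<open>D > 4 * \<delta>\<close>, one factor \<open>1 / sqrt D\<close> is
      at most \<open>\<Lambda> powr (m / 4) / 2\<close>, and \<open>m / 4 \<le> 1 - m / 2\<close>
      for \<open>m < 1\<close>.\<close>
    also have "\<dots> \<le> 20 * \<Lambda> powr (1 - m / 2) * (1 / sqrt D)"
    proof -
      define r where "r = \<Lambda> powr (- m / 4)"
      have r: "r > 0" using \<Lambda>0 by (simp add: r_def)
      have "\<delta> = r\<^sup>2" using \<Lambda>0 by (simp add: \<delta>_def r_def power2_eq_square powr_add[symmetric])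
      then have "(2 * r)\<^sup>2 \<le> D" using 3(1) by (simp add: power2_eq_square)
      then have "2 * r \<le> sqrt D" by (rule real_le_rsqrt)
      then have "1 / sqrt D \<le> 1 / (2 * r)" using r D by (intro divide_left_mono) auto
      also have "1 / (2 * r) = \<Lambda> powr (m / 4) / 2" using \<Lambda>0 by (simp add: r_def powr_minus_divide)
      also have "\<dots> \<le> \<Lambda> powr (1 - m / 2) / 2" using \<Lambda> m by (intro divide_right_mono powr_mono) auto
      finally have "40 * (1 / sqrt D) \<le> 20 * \<Lambda> powr (1 - m / 2)" by simp
      then show ?thesis using D by (intro mult_right_mono) auto
    qed
    also have "\<dots> \<le> (48 / sqrt c + 20) * \<Lambda> powr (1 - m / 2) * (1 / sqrt D)"
      using c D by (simp add: algebra_simps)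
    finally show ?thesis using \<Lambda>0 by (smt (verit) indicator_pos_le mult_nonneg_nonneg)
  qed
  then show ?thesis by (simp add: A_def D_def c_def)
qed

section \<open>The maximal estimate for one dyadic piece\<close>

lemma Cauchy_Schwarz_integral:
  fixes f h :: "'a \<Rightarrow> real"
  assumes [measurable]: "f \<in> borel_measurable M" "h \<in> borel_measurable M"
    and f2: "integrable M (\<lambda>x. (f x)\<^sup>2)" and h2: "integrable M (\<lambda>x. (h x)\<^sup>2)"
  shows "integrable M (\<lambda>x. f x * h x)"
    and "(\<integral>x. f x * h x \<partial>M)\<^sup>2 \<le> (\<integral>x. (f x)\<^sup>2 \<partial>M) * (\<integral>x. (h x)\<^sup>2 \<partial>M)"
proof -
  have "\<bar>f x * h x\<bar> \<le> (f x)\<^sup>2 + (h x)\<^sup>2" for x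
  proof -
    have "0 \<le> \<bar>f x\<bar> * \<bar>h x\<bar>" by simp
    then show ?thesis using sum_squares_bound[of "\<bar>f x\<bar>" "\<bar>h x\<bar>"] unfolding abs_mult power2_abs by linarith
  qed
  then show fh: "integrable M (\<lambda>x. f x * h x)"
    by (intro Bochner_Integration.integrable_bound[OF Bochner_Integration.integrable_add[OF f2 h2]])
       (auto simp: abs_mult)
  define F H I where "F = (\<integral>x. (f x)\<^sup>2 \<partial>M)" and "H = (\<integral>x. (h x)\<^sup>2 \<partial>M)" and "I = (\<integral>x. f x * h x \<partial>M)"
  \<comment> \<open>The discriminant argument: the square of \<open>p * f - q * h\<close> has a
    nonnegative integral for all \<open>p\<close> and \<open>q\<close>.\<close>
  have quad: "0 \<le> p\<^sup>2 * F - 2 * p * q * I + q\<^sup>2 * H" for p q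
  proof -
    have "0 \<le> (\<integral>x. (p * f x - q * h x)\<^sup>2 \<partial>M)" by simp
    also have "(\<lambda>x. (p * f x - q * h x)\<^sup>2) = (\<lambda>x. p\<^sup>2 * (f x)\<^sup>2 - 2 * p * q * (f x * h x) + q\<^sup>2 * (h x)\<^sup>2)"
      by (auto simp: power2_eq_square algebra_simps)
    also have "(\<integral>x. p\<^sup>2 * (f x)\<^sup>2 - 2 * p * q * (f x * h x) + q\<^sup>2 * (h x)\<^sup>2 \<partial>M) = p\<^sup>2 * F - 2 * p * q * I + q\<^sup>2 * H"
      using f2 h2 fh by (simp add: F_def H_def I_def)
    finally show ?thesis .
  qed
  have "F \<ge> 0" "H \<ge> 0" by (auto simp: F_def H_def)
  have "I\<^sup>2 \<le> F * H"
  proof (cases "H = 0")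
    case True
    have "0 \<le> F - 2 * q * I" for q using quad[of 1 q] True by simp
    \<comment> \<open>For \<open>H = 0\<close> the form is affine in \<open>q\<close>, and this
      \<open>q\<close> gives it the value \<open>-1\<close> unless \<open>I = 0\<close>.\<close>
    from this[of "(F + 1) / (2 * I)"] have "I = 0" by (cases "I = 0") (auto simp: field_simps)
    then show ?thesis using True by simp
  next
    case False
    then have "H > 0" using \<open>H \<ge> 0\<close> by simp
    have "0 \<le> H * (F * H - I\<^sup>2)" using quad[of H I] by (simp add: power2_eq_square algebra_simps)
    then show ?thesis using \<open>H > 0\<close> by (simp add: zero_le_mult_iff)
  qed
  then show "(\<integral>x. f x * h x \<partial>M)\<^sup>2 \<le> (\<integral>x. (f x)\<^sup>2 \<partial>M) * (\<integral>x. (h x)\<^sup>2 \<partial>M)"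
    by (simp add: F_def H_def I_def)
qed

text \<open>If \<open>f\<close> is not integrable, its integral is 0 by convention, while
  \<open>h\<close> is nonnegative because it dominates a norm.\<close>

lemma integral_norm_le:
  fixes f :: "'a \<Rightarrow> 'b::{banach, second_countable_topology}"
  assumes "integrable M h" "\<And>x. x \<in> space M \<Longrightarrow> norm (f x) \<le> h x"
  shows "norm (\<integral>x. f x \<partial>M) \<le> (\<integral>x. h x \<partial>M)"
proof (cases "integrable M f")
  case True
  have "norm (\<integral>x. f x \<partial>M) \<le> (\<integral>x. norm (f x) \<partial>M)" by (rule integral_norm_bound)
  also have "\<dots> \<le> (\<integral>x. h x \<partial>M)" using True assms by (intro integral_mono) auto
  finally show ?thesis .
next
  case False
  have "0 \<le> h x" if "x \<in> space M" for x using assms(2)[OF that] norm_ge_zero order_trans by blast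
  then show ?thesis using False by (simp add: not_integrable_integral_eq)
qed

text \<open>
  The \<open>L\<^sup>1\<close> norm is tested against a unimodular function \<open>u\<close>, so that only the absolute value
  of the kernel of \<open>T T\<^sup>*\<close> enters and no Plancherel theorem is needed.
\<close>
lemma TT_star_L1_bound:
  fixes a :: "'a \<Rightarrow> 'b \<Rightarrow> complex"
  assumes M: "finite_measure M" and N: "finite_measure N"
    and a [measurable]: "(\<lambda>(x, \<xi>). a x \<xi>) \<in> borel_measurable (M \<Otimes>\<^sub>M N)"
    and a1: "\<And>x \<xi>. cmod (a x \<xi>) \<le> 1"
    and g [measurable]: "g \<in> borel_measurable N" and g2: "integrable N (\<lambda>\<xi>. (cmod (g \<xi>))\<^sup>2)"
  shows "(\<integral>x. cmod (\<integral>\<xi>. a x \<xi> * g \<xi> \<partial>N) \<partial>M)\<^sup>2 \<le>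
    (\<integral>\<xi>. (cmod (g \<xi>))\<^sup>2 \<partial>N) * (\<integral>x. \<integral>x'. cmod (\<integral>\<xi>. a x \<xi> * cnj (a x' \<xi>) \<partial>N) \<partial>M \<partial>M)"
proof -
  interpret M: finite_measure M by (rule M)
  interpret N: finite_measure N by (rule N)
  interpret MN: pair_sigma_finite M N ..
  interpret MM: pair_sigma_finite M M ..
  interpret fMN: finite_measure "M \<Otimes>\<^sub>M N" by (rule finite_measure_pair_measure) unfold_locales
  have g1: "integrable N (\<lambda>\<xi>. cmod (g \<xi>))"
    using Cauchy_Schwarz_integral(1)[of "\<lambda>\<xi>. cmod (g \<xi>)" N "\<lambda>_. 1"] g2 by simp
  define T where "T x = (\<integral>\<xi>. a x \<xi> * g \<xi> \<partial>N)" for x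
  \<comment> \<open>The conjugate sign of \<open>T\<close>, so that \<open>u x * T x\<close> is the
    modulus of \<open>T x\<close>. Where \<open>T\<close> vanishes \<open>u\<close> is 0, hence the
    bound \<open>cmod (u x) \<le> 1\<close> rather than an equality.\<close>
  define u where "u x = cnj (sgn (T x))" for x
  \<comment> \<open>Up to conjugation, the adjoint operator applied to the test function. Fubini
    turns the norm of \<open>T\<close> in the mean into the pairing of \<open>b\<close> with
    \<open>g\<close>, and Cauchy-Schwarz leaves the square norm of \<open>b\<close>.\<close>
  define b where "b \<xi> = (\<integral>x. u x * a x \<xi> \<partial>M)" for \<xi>
  define K where "K x x' = (\<integral>\<xi>. a x \<xi> * cnj (a x' \<xi>) \<partial>N)" for x x'
  have T [measurable]: "T \<in> borel_measurable M" unfolding T_def by measurable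
  have [measurable]: "sgn \<in> borel_measurable (borel :: complex measure)"
    unfolding sgn_div_norm[abs_def] by measurable
  have u [measurable]: "u \<in> borel_measurable M" unfolding u_def by measurable
  have u1: "cmod (u x) \<le> 1" for x by (simp add: u_def norm_sgn)
  have uT: "u x * T x = of_real (cmod (T x))" for x
  proof -
    have "cnj (sgn (T x)) * T x = of_real ((cmod (T x))\<^sup>2) / of_real (cmod (T x))"
      unfolding complex_norm_square by (simp add: sgn_eq mult.commute)
    then show ?thesis by (simp add: u_def power2_eq_square)
  qed
  have b [measurable]: "b \<in> borel_measurable N" unfolding b_def by measurable
  have K [measurable]: "(\<lambda>(x, x'). K x x') \<in> borel_measurable (M \<Otimes>\<^sub>M M)" unfolding K_def by measurable
  have b_le: "cmod (b \<xi>) \<le> measure M (space M)" for \<xi>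
  proof -
    have "cmod (b \<xi>) \<le> (\<integral>x. 1 \<partial>M)" unfolding b_def
      by (rule integral_norm_le) (auto simp: norm_mult intro!: mult_le_one u1 a1)
    then show ?thesis by simp
  qed
  have K_le: "cmod (K x x') \<le> measure N (space N)" for x x'
  proof -
    have "cmod (K x x') \<le> (\<integral>x. 1 \<partial>N)" unfolding K_def
      by (rule integral_norm_le) (auto simp: norm_mult intro!: mult_le_one a1)
    then show ?thesis by simp
  qed
  have b2: "integrable N (\<lambda>\<xi>. (cmod (b \<xi>))\<^sup>2)"
    by (rule N.integrable_const_bound[where B="(measure M (space M))\<^sup>2"]) (auto intro!: power_mono b_le)

  have "of_real (\<integral>x. cmod (T x) \<partial>M) = (\<integral>x. (\<integral>\<xi>. u x * a x \<xi> * g \<xi> \<partial>N) \<partial>M)"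
  proof -
    have "u x * T x = (\<integral>\<xi>. u x * a x \<xi> * g \<xi> \<partial>N)" for x
      unfolding T_def integral_mult_right_zero[symmetric] by (simp only: mult.assoc)
    then show ?thesis unfolding integral_complex_of_real[symmetric] uT[symmetric] by simp
  qed
  also have "\<dots> = (\<integral>\<xi>. (\<integral>x. u x * a x \<xi> * g \<xi> \<partial>M) \<partial>N)"
  proof (rule MN.Fubini_integral[symmetric])
    have "integrable (M \<Otimes>\<^sub>M N) (\<lambda>(x, \<xi>). cmod (g \<xi>))"
      by (intro MN.Fubini_integrable) (auto intro: g1)
    then show "integrable (M \<Otimes>\<^sub>M N) (\<lambda>(x, \<xi>). u x * a x \<xi> * g \<xi>)"
      by (rule Bochner_Integration.integrable_bound)
         (measurable, auto simp: norm_mult split_beta' intro!: AE_I2 mult_left_le_one_le mult_le_one u1 a1)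
  qed
  also have "\<dots> = (\<integral>\<xi>. b \<xi> * g \<xi> \<partial>N)" by (simp add: b_def)
  finally have "cmod (of_real (\<integral>x. cmod (T x) \<partial>M)) = cmod (\<integral>\<xi>. b \<xi> * g \<xi> \<partial>N)"
    by (rule arg_cong)
  then have "(\<integral>x. cmod (T x) \<partial>M) = cmod (\<integral>\<xi>. b \<xi> * g \<xi> \<partial>N)" by simp
  also have "\<dots> \<le> (\<integral>\<xi>. cmod (b \<xi>) * cmod (g \<xi>) \<partial>N)"
    by (rule order_trans[OF integral_norm_bound]) (simp add: norm_mult)
  finally have "(\<integral>x. cmod (T x) \<partial>M)\<^sup>2 \<le> (\<integral>\<xi>. cmod (b \<xi>) * cmod (g \<xi>) \<partial>N)\<^sup>2"
    by (intro power_mono) auto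
  also have "\<dots> \<le> (\<integral>\<xi>. (cmod (b \<xi>))\<^sup>2 \<partial>N) * (\<integral>\<xi>. (cmod (g \<xi>))\<^sup>2 \<partial>N)"
    by (rule Cauchy_Schwarz_integral(2)) (use b2 g2 in auto)
  also have "\<dots> \<le> (\<integral>x. \<integral>x'. cmod (K x x') \<partial>M \<partial>M) * (\<integral>\<xi>. (cmod (g \<xi>))\<^sup>2 \<partial>N)"
  proof (rule mult_right_mono)
    \<comment> \<open>The square norm of \<open>b\<close> is expanded into a double integral over
      \<open>x\<close> and \<open>x'\<close>; integrating in \<open>\<xi>\<close> first produces
      \<open>K\<close>. The interchanges hold because all factors are bounded and the measures
      finite. The factors \<open>u\<close> then drop out in absolute value.\<close>
    have "of_real (\<integral>\<xi>. (cmod (b \<xi>))\<^sup>2 \<partial>N) = (\<integral>\<xi>. (\<integral>x. u x * a x \<xi> * cnj (b \<xi>) \<partial>M) \<partial>N)"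
      unfolding integral_complex_of_real[symmetric] complex_norm_square
      by (simp add: b_def)
    also have "\<dots> = (\<integral>x. (\<integral>\<xi>. u x * a x \<xi> * cnj (b \<xi>) \<partial>N) \<partial>M)"
    proof (rule MN.Fubini_integral)
      show "integrable (M \<Otimes>\<^sub>M N) (\<lambda>(x, \<xi>). u x * a x \<xi> * cnj (b \<xi>))"
        by (rule fMN.integrable_const_bound[where B="1 * 1 * measure M (space M)"])
           (measurable, auto simp only: norm_mult split_beta' intro!: AE_I2 mult_mono u1 a1 b_le, auto simp: b_le)
    qed
    also have "\<dots> = (\<integral>x. (\<integral>\<xi>. (\<integral>x'. u x * a x \<xi> * cnj (u x') * cnj (a x' \<xi>) \<partial>M) \<partial>N) \<partial>M)"
    proof -
      have "u x * a x \<xi> * cnj (b \<xi>) = (\<integral>x'. u x * a x \<xi> * cnj (u x') * cnj (a x' \<xi>) \<partial>M)" for x \<xi>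
      proof -
        have "u x * a x \<xi> * cnj (b \<xi>) = u x * a x \<xi> * (\<integral>x'. cnj (u x' * a x' \<xi>) \<partial>M)"
          by (simp only: b_def Bochner_Integration.integral_cnj)
        then show ?thesis by (simp only: integral_mult_right_zero[symmetric] complex_cnj_mult mult.assoc)
      qed
      then show ?thesis by simp
    qed
    also have "\<dots> = (\<integral>x. (\<integral>x'. (\<integral>\<xi>. u x * a x \<xi> * cnj (u x') * cnj (a x' \<xi>) \<partial>N) \<partial>M) \<partial>M)"
    proof (rule Bochner_Integration.integral_cong[OF refl])
      fix x assume [measurable]: "x \<in> space M"
      show "(\<integral>\<xi>. (\<integral>x'. u x * a x \<xi> * cnj (u x') * cnj (a x' \<xi>) \<partial>M) \<partial>N)
          = (\<integral>x'. (\<integral>\<xi>. u x * a x \<xi> * cnj (u x') * cnj (a x' \<xi>) \<partial>N) \<partial>M)"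
      proof (rule MN.Fubini_integral)
        show "integrable (M \<Otimes>\<^sub>M N) (\<lambda>(x', \<xi>). u x * a x \<xi> * cnj (u x') * cnj (a x' \<xi>))"
          by (rule fMN.integrable_const_bound[where B="1 * 1 * 1 * 1"])
             (measurable, auto simp only: norm_mult split_beta' complex_mod_cnj intro!: AE_I2 mult_mono u1 a1, auto)
      qed
    qed
    also have "\<dots> = (\<integral>x. (\<integral>x'. u x * cnj (u x') * K x x' \<partial>M) \<partial>M)"
      unfolding K_def integral_mult_right_zero[symmetric] by (simp only: mult_ac)
    finally have "(\<integral>\<xi>. (cmod (b \<xi>))\<^sup>2 \<partial>N) = cmod (\<integral>x. (\<integral>x'. u x * cnj (u x') * K x x' \<partial>M) \<partial>M)"
      by (metis (no_types, lifting) Bochner_Integration.integral_nonneg zero_le_power2 norm_of_real abs_of_nonneg)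
    also have "\<dots> \<le> (\<integral>x. (\<integral>x'. cmod (K x x') \<partial>M) \<partial>M)"
    proof (rule integral_norm_le)
      have Ki: "integrable M (\<lambda>x'. cmod (K x x'))" if [measurable]: "x \<in> space M" for x
        by (rule M.integrable_const_bound[where B="measure N (space N)"]) (auto simp: K_le)
      have "integrable (M \<Otimes>\<^sub>M M) (\<lambda>(x, x'). cmod (K x x'))"
        using K_le
        by (intro finite_measure.integrable_const_bound[OF finite_measure_pair_measure[OF M M], where B="measure N (space N)"]) auto
      then show "integrable M (\<lambda>x. \<integral>x'. cmod (K x x') \<partial>M)"
        using MM.integrable_fst by auto
      fix x assume "x \<in> space M"
      then show "cmod (\<integral>x'. u x * cnj (u x') * K x x' \<partial>M) \<le> (\<integral>x'. cmod (K x x') \<partial>M)"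
        by (intro integral_norm_le)
           (auto simp: norm_mult Ki intro!: mult_left_le_one_le mult_le_one u1)
    qed
    finally show "(\<integral>\<xi>. (cmod (b \<xi>))\<^sup>2 \<partial>N) \<le> (\<integral>x. \<integral>x'. cmod (K x x') \<partial>M \<partial>M)" .
  qed simp
  finally show ?thesis by (simp add: T_def K_def mult.commute)
qed

section \<open>The kernel majorant and the linearised maximal function\<close>

lemma integrable_inverse_sqrt_abs:
  "integrable lborel (\<lambda>u::real. indicator {-r..r} u * (1 / sqrt \<bar>u\<bar>))"
proof (cases "r \<ge> 0")
  case True
  define k where "k u = indicator {0..r} u * (1 / sqrt \<bar>u\<bar>)" for u :: real
  have "(\<lambda>u. u powr (-1/2)) integrable_on {0..r}"
    by (rule integrable_on_powr_from_0) (use True in auto)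
  then have "(\<lambda>u. u powr (-1/2)) absolutely_integrable_on {0..r}"
    by (rule nonnegative_absolutely_integrable_1) auto
  then have "integrable lebesgue (\<lambda>u. indicator {0..r} u *\<^sub>R (u powr (-1/2)))"
    by (simp add: set_integrable_def)
  then have "integrable lborel (\<lambda>u::real. indicator {0..r} u *\<^sub>R (u powr (-1/2)))"
    by (subst (asm) integrable_completion) auto
  also have "(\<lambda>u::real. indicator {0..r} u *\<^sub>R (u powr (-1/2))) = k"
  proof
    fix u :: real
    show "indicator {0..r} u *\<^sub>R (u powr (-1/2)) = k u"
      \<comment> \<open>At the singularity both expressions take the default value 0.\<close>
      by (cases "u = 0") (auto simp: k_def indicator_def powr_minus_divide powr_half_sqrt)
  qed
  finally have k: "integrable lborel k" .
  then have "integrable lborel (\<lambda>u. k u + k (0 + (-1) * u))"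
    by (intro Bochner_Integration.integrable_add lborel_integrable_real_affine) auto
  then show ?thesis
    by (rule Bochner_Integration.integrable_bound) (auto simp: k_def indicator_def)
qed simp

text \<open>
  The parameter \<open>p\<close> is a triple \<open>(\<theta>, t, \<mu>)\<close>, where \<open>\<mu>\<close> stands for \<open>1 / N\<^sup>2\<close>, so that
  \<open>\<mu> = 0\<close> is the limit \<open>N \<longlonglongrightarrow> \<infinity>\<close> and \<open>p\<close> ranges over a compact set. The translation
  by \<open>- \<theta> t\<close> is part of the multiplier.
\<close>
definition symbol :: "real \<Rightarrow> real \<times> real \<times> real \<Rightarrow> real \<Rightarrow> complex" where
  "symbol m p \<xi> = cis (fst (snd p) * \<bar>\<xi>\<bar> powr m - fst p * fst (snd p) * \<xi>) *
     of_real (exp (- (snd (snd p) * \<xi>\<^sup>2)))"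

text \<open>The part of the evolution with frequencies in \<open>J\<close>, without the factor
  \<open>1 / (2 * pi)\<close>, which returns only in the final theorem.\<close>

definition piece :: "real \<Rightarrow> real set \<Rightarrow> (real \<Rightarrow> complex) \<Rightarrow> real \<times> real \<times> real \<Rightarrow> real \<Rightarrow> complex" where
  "piece m J g p x = (LINT \<xi>:J|lborel. cis (x * \<xi>) * symbol m p \<xi> * g \<xi>)"

definition annulus :: "real \<Rightarrow> real set" where
  "annulus \<Lambda> = {\<xi>. \<Lambda> \<le> \<bar>\<xi>\<bar> \<and> \<bar>\<xi>\<bar> < 2 * \<Lambda>}"

lemma annulus_measurable [measurable]: "annulus \<Lambda> \<in> sets borel"
  unfolding annulus_def by measurable

lemma borel_measurable_symbol [measurable (raw)]:
  assumes [measurable]: "p \<in> M \<rightarrow>\<^sub>M borel" "f \<in> borel_measurable M"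
  shows "(\<lambda>x. symbol m (p x) (f x)) \<in> borel_measurable M"
proof -
  have [measurable]: "fst \<in> borel_measurable (borel :: (real \<times> real \<times> real) measure)"
    "snd \<in> (borel :: (real \<times> real \<times> real) measure) \<rightarrow>\<^sub>M borel"
    "fst \<in> borel_measurable (borel :: (real \<times> real) measure)"
    "snd \<in> borel_measurable (borel :: (real \<times> real) measure)"
    by (auto intro!: borel_measurable_continuous_onI continuous_intros)
  show ?thesis unfolding symbol_def by measurable
qed

lemma norm_symbol: "0 \<le> snd (snd p) \<Longrightarrow> cmod (symbol m p \<xi>) \<le> 1"
  by (simp add: symbol_def norm_mult)

lemma borel_measurable_piece [measurable]:
  assumes [measurable]: "sel \<in> borel \<rightarrow>\<^sub>M borel" "g \<in> borel_measurable borel" "J \<in> sets borel"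
  shows "(\<lambda>x. piece m J g (sel x) x) \<in> borel_measurable borel"
  unfolding piece_def set_lebesgue_integral_def by measurable

text \<open>Restriction to \<open>E\<close> is modelled by a density, so that the measurable sets
  remain the Borel sets of the whole line and \<open>TT_star_L1_bound\<close> applies to globally
  defined functions.\<close>

lemma finite_measure_density_indicator:
  fixes E :: "real set"
  assumes [measurable]: "E \<in> sets borel" and "emeasure lborel E < \<infinity>"
  shows "finite_measure (density lborel (\<lambda>x. ennreal (indicator E x)))"
  by (rule finite_measureI) (use assms in \<open>simp add: emeasure_density ennreal_indicator\<close>)

lemma integral_density_indicator:
  fixes f :: "real \<Rightarrow> 'b::{banach, second_countable_topology}"
  assumes [measurable]: "E \<in> sets borel" "f \<in> borel_measurable borel"
  shows "integral\<^sup>L (density lborel (\<lambda>x. ennreal (indicator E x))) f = (LINT x:E|lborel. f x)"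
  unfolding set_lebesgue_integral_def by (subst integral_density) auto

lemma emeasure_annulus: "emeasure lborel (annulus \<Lambda>) < \<infinity>"
proof -
  have "emeasure lborel (annulus \<Lambda>) \<le> emeasure lborel {-2 * \<Lambda>..2 * \<Lambda>}"
    by (rule emeasure_mono) (auto simp: annulus_def)
  then show ?thesis by (simp add: emeasure_lborel_Icc_eq less_top[symmetric] top_unique) (auto simp: top_unique)
qed

text \<open>The integral of the kernel majorant divided by
  \<open>\<Lambda> powr (1 - m / 2)\<close>. The interval contains all differences of points of
  \<open>{-R..R}\<close>, and 16 comes from the height \<open>2 * \<Lambda>\<close> on an interval
  of length \<open>8 * \<delta>\<close>.\<close>

definition block_const :: "real \<Rightarrow> real \<Rightarrow> real \<Rightarrow> real" where
  "block_const m M R = (48 / sqrt (m * (1 - m) / (4 * (M + 1))) + 20) *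
     (LINT u|lborel. indicator {-2 * R..2 * R} u * (1 / sqrt \<bar>u\<bar>)) + 16"

lemma block_const_pos:
  assumes "0 < m" "m < 1" "0 \<le> M"
  shows "0 < block_const m M R"
proof -
  have "0 \<le> (LINT u|lborel. indicator {-2 * R..2 * R} u * (1 / sqrt \<bar>u\<bar>))"
    by (rule Bochner_Integration.integral_nonneg) (auto simp: indicator_def)
  moreover have "0 \<le> 48 / sqrt (m * (1 - m) / (4 * (M + 1))) + 20"
    using assms by simp
  ultimately show ?thesis unfolding block_const_def by (intro add_nonneg_pos mult_nonneg_nonneg) auto
qed

text \<open>\<open>TT_star_L1_bound\<close> on \<open>E\<close> with the parameter frozen to
  \<open>sel x\<close>: the kernel is a \<open>dyadic_kernel\<close>, whose bound \<open>k\<close>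
  depends only on \<open>x - x'\<close>, so the double integral over \<open>E\<close> is at most the
  integral of \<open>k\<close> times the measure of \<open>E\<close>. Keeping this measure as a
  factor lets disjoint blocks be added efficiently.\<close>

lemma block_estimate:
  fixes m \<Lambda> M R c :: real and sel :: "real \<Rightarrow> real \<times> real \<times> real"
  defines "\<delta> \<equiv> \<Lambda> powr (- m / 2)"
  assumes m: "0 < m" "m < 1" and \<Lambda>: "1 \<le> \<Lambda>" and M: "0 \<le> M"
    and sel [measurable]: "sel \<in> borel \<rightarrow>\<^sub>M borel"
    and P: "\<And>x. \<bar>fst (sel x)\<bar> \<le> M" "\<And>x. \<bar>fst (snd (sel x))\<bar> \<le> 1" "\<And>x. 0 \<le> snd (snd (sel x))"
    and E [measurable]: "E \<in> sets borel" and ER: "E \<subseteq> {-R..R}"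
    and c: "\<And>x. x \<in> E \<Longrightarrow> fst (sel x) \<in> {c..c + \<delta>}"
    and g [measurable]: "g \<in> borel_measurable borel"
    and g2: "set_integrable lborel (annulus \<Lambda>) (\<lambda>\<xi>. (cmod (g \<xi>))\<^sup>2)"
  shows "(LINT x:E|lborel. cmod (piece m (annulus \<Lambda>) g (sel x) x))\<^sup>2
    \<le> (LINT \<xi>:annulus \<Lambda>|lborel. (cmod (g \<xi>))\<^sup>2) * (block_const m M R * \<Lambda> powr (1 - m / 2)) * measure lborel E"
proof -
  define MM where "MM = density lborel (\<lambda>x. ennreal (indicator E x))"
  define NN where "NN = density lborel (\<lambda>x. ennreal (indicator (annulus \<Lambda>) x))"
  define a where "a x \<xi> = cis (x * \<xi>) * symbol m (sel x) \<xi>" for x \<xi>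
  have [measurable_cong]: "sets MM = sets borel" "sets NN = sets borel" by (auto simp: MM_def NN_def)
  have Efin: "emeasure lborel E < \<infinity>"
  proof -
    have "emeasure lborel E \<le> emeasure lborel {-R..R}" by (rule emeasure_mono) (use ER in auto)
    also have "\<dots> < \<infinity>" by (simp add: emeasure_lborel_Icc_eq)
    finally show ?thesis .
  qed
  have a_meas: "(\<lambda>(x, \<xi>). a x \<xi>) \<in> borel_measurable (MM \<Otimes>\<^sub>M NN)" unfolding a_def by measurable
  have ab [measurable]: "(\<lambda>x. a (p x) (q x)) \<in> borel_measurable borel"
    if [measurable]: "p \<in> borel_measurable borel" "q \<in> borel_measurable borel" for p q :: "real \<Rightarrow> real"
    unfolding a_def by measurable
  have a1: "cmod (a x \<xi>) \<le> 1" for x \<xi>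
    unfolding a_def norm_mult using norm_symbol[OF P(3)] by simp
  have Kmeas: "(\<lambda>x'. LINT \<xi>:annulus \<Lambda>|lborel. a x \<xi> * cnj (a x' \<xi>)) \<in> borel_measurable borel"
    and Kmeas2: "(\<lambda>x. LINT x':E|lborel. cmod (LINT \<xi>:annulus \<Lambda>|lborel. a x \<xi> * cnj (a x' \<xi>))) \<in> borel_measurable borel" for x
    unfolding a_def set_lebesgue_integral_def by measurable
  have TT: "(\<integral>x. cmod (\<integral>\<xi>. a x \<xi> * g \<xi> \<partial>NN) \<partial>MM)\<^sup>2 \<le>
    (\<integral>\<xi>. (cmod (g \<xi>))\<^sup>2 \<partial>NN) * (\<integral>x. \<integral>x'. cmod (\<integral>\<xi>. a x \<xi> * cnj (a x' \<xi>) \<partial>NN) \<partial>MM \<partial>MM)"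
  proof (rule TT_star_L1_bound[OF _ _ a_meas a1])
    show "finite_measure MM" "finite_measure NN" unfolding MM_def NN_def
      using Efin emeasure_annulus by (auto intro!: finite_measure_density_indicator)
    show "integrable NN (\<lambda>\<xi>. (cmod (g \<xi>))\<^sup>2)" unfolding NN_def
      by (subst integrable_density) (use g2 in \<open>auto simp: set_integrable_def\<close>)
    show "g \<in> borel_measurable NN" by measurable
  qed
  define K where "K x x' = (LINT \<xi>:annulus \<Lambda>|lborel. a x \<xi> * cnj (a x' \<xi>))" for x x'
  have N_eq: "(\<integral>\<xi>. a x \<xi> * g \<xi> \<partial>NN) = piece m (annulus \<Lambda>) g (sel x) x" for x
    unfolding NN_def piece_def a_def by (rule integral_density_indicator) measurable
  have K_eq: "(\<integral>\<xi>. a x \<xi> * cnj (a x' \<xi>) \<partial>NN) = K x x'" for x x'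
    unfolding NN_def K_def by (rule integral_density_indicator) measurable
  have g_eq: "(\<integral>\<xi>. (cmod (g \<xi>))\<^sup>2 \<partial>NN) = (LINT \<xi>:annulus \<Lambda>|lborel. (cmod (g \<xi>))\<^sup>2)"
    unfolding NN_def by (rule integral_density_indicator) measurable
  have [measurable]: "K x \<in> borel_measurable borel" for x using Kmeas[of x] unfolding K_def[abs_def] .
  have [measurable]: "(\<lambda>x. LINT x':E|lborel. cmod (K x x')) \<in> borel_measurable borel" using Kmeas2 by (simp add: K_def)
  have E_eq: "(\<integral>x. f x \<partial>MM) = (LINT x:E|lborel. f x)" if [measurable]: "f \<in> borel_measurable borel" for f :: "real \<Rightarrow> real"
    unfolding MM_def by (rule integral_density_indicator) measurable
  define C where "C = 48 / sqrt (m * (1 - m) / (4 * (M + 1))) + 20"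
  \<comment> \<open>The bound of \<open>dyadic_kernel_bound\<close> as a function of
    \<open>u = x - x'\<close>, cut off to the differences that occur, which makes the inverse square
    root integrable.\<close>
  define k where "k u = C * \<Lambda> powr (1 - m / 2) * (indicator {-2 * R..2 * R} u * (1 / sqrt \<bar>u\<bar>))
      + 2 * \<Lambda> * indicator {- 4 * \<delta>..4 * \<delta>} u" for u :: real
  have C: "C \<ge> 0" using m M by (simp add: C_def)
  have \<Lambda>0: "\<Lambda> > 0" using \<Lambda> by simp
  have \<delta>0: "\<delta> > 0" using \<Lambda> by (simp add: \<delta>_def)
  have k0: "0 \<le> k u" for u using C \<Lambda>0 by (simp add: k_def)
  have k_int: "integrable lborel k" unfolding k_def[abs_def]
    by (intro Bochner_Integration.integrable_add integrable_mult_right)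
       (use integrable_inverse_sqrt_abs[of "2 * R"] in \<open>auto simp: integrable_real_indicator emeasure_lborel_Icc_eq\<close>)
  have k_val: "integral\<^sup>L lborel k = block_const m M R * \<Lambda> powr (1 - m / 2)"
  proof -
    have "integral\<^sup>L lborel k = C * \<Lambda> powr (1 - m / 2) * (LINT u|lborel. indicator {-2 * R..2 * R} u * (1 / sqrt \<bar>u\<bar>))
       + 2 * \<Lambda> * (8 * \<delta>)"
      unfolding k_def[abs_def]
    proof (subst Bochner_Integration.integral_add)
      show "integrable lborel (\<lambda>u. C * \<Lambda> powr (1 - m / 2) * (indicator {-2 * R..2 * R} u * (1 / sqrt \<bar>u\<bar>)))"
        using integrable_inverse_sqrt_abs[of "2 * R"] by (intro integrable_mult_right) simp
    qed (use \<delta>0 in \<open>auto simp only: integral_mult_right_zero, auto simp: integrable_real_indicator emeasure_lborel_Icc_eq\<close>)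
    also have "\<Lambda> * \<delta> = \<Lambda> powr (1 - m / 2)"
      using \<Lambda>0 powr_add[of \<Lambda> 1 "- m / 2"] by (simp add: \<delta>_def)
    then have "2 * \<Lambda> * (8 * \<delta>) = 16 * \<Lambda> powr (1 - m / 2)" by simp
    finally show ?thesis by (simp add: block_const_def C_def algebra_simps)
  qed
  have Kk: "cmod (K x x') \<le> k (x - x')" if x: "x \<in> E" "x' \<in> E" for x x'
  proof -
    obtain \<theta> t \<mu> where s: "sel x = (\<theta>, t, \<mu>)" using prod_cases3 by blast
    obtain \<theta>' t' \<mu>' where s': "sel x' = (\<theta>', t', \<mu>')" using prod_cases3 by blast
    \<comment> \<open>Multiplying one symbol by the conjugate of the other subtracts the phases and
      adds the Gaussian exponents.\<close>
    have "K x x' = dyadic_kernel m \<Lambda> (\<mu> + \<mu>') (x - x' - \<theta> * t + \<theta>' * t') (t - t')"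
      unfolding K_def annulus_def
    proof (subst dyadic_kernel_def[OF m \<Lambda>0], use P(3)[of x] P(3)[of x'] s s' in simp, rule set_lebesgue_integral_cong)
      show "\<forall>\<xi>. \<xi> \<in> {\<xi>. \<Lambda> \<le> \<bar>\<xi>\<bar> \<and> \<bar>\<xi>\<bar> < 2 * \<Lambda>} \<longrightarrow> a x \<xi> * cnj (a x' \<xi>) =
        cis ((x - x' - \<theta> * t + \<theta>' * t') * \<xi> + (t - t') * \<bar>\<xi>\<bar> powr m) * of_real (exp (- ((\<mu> + \<mu>') * \<xi>\<^sup>2)))"
      proof (intro allI impI)
        fix \<xi>
        have "a x \<xi> * cnj (a x' \<xi>) = (cis (x * \<xi>) * cis (t * \<bar>\<xi>\<bar> powr m - \<theta> * t * \<xi>) *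
          (cis (- (x' * \<xi>)) * cis (- (t' * \<bar>\<xi>\<bar> powr m - \<theta>' * t' * \<xi>)))) *
          of_real (exp (- (\<mu> * \<xi>\<^sup>2)) * exp (- (\<mu>' * \<xi>\<^sup>2)))"
          by (simp add: a_def symbol_def s s' cis_cnj)
        then show "a x \<xi> * cnj (a x' \<xi>) =
        cis ((x - x' - \<theta> * t + \<theta>' * t') * \<xi> + (t - t') * \<bar>\<xi>\<bar> powr m) * of_real (exp (- ((\<mu> + \<mu>') * \<xi>\<^sup>2)))"
          unfolding cis_mult exp_add[symmetric] by (simp add: algebra_simps)
      qed
    qed (use annulus_measurable in \<open>simp add: annulus_def\<close>)
    moreover have "cmod (dyadic_kernel m \<Lambda> (\<mu> + \<mu>') (x - x' - \<theta> * t + \<theta>' * t') (t - t'))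
    \<le> C * \<Lambda> powr (1 - m / 2) * (1 / sqrt \<bar>x - x'\<bar>)
      + 2 * \<Lambda> * indicator {- 4 * \<delta>..4 * \<delta>} (x - x')"
      unfolding C_def \<delta>_def
    proof (rule dyadic_kernel_bound[OF m \<Lambda>])
      show "\<bar>\<theta> - \<theta>'\<bar> \<le> \<Lambda> powr (- m / 2)"
        using c[OF x(1)] c[OF x(2)] s s' by (auto simp: \<delta>_def abs_le_iff)
    qed (use P[of x] P[of x'] s s' in auto)
    moreover have "x - x' \<in> {-2 * R..2 * R}" using subsetD[OF ER x(1)] subsetD[OF ER x(2)] by auto
    ultimately show ?thesis by (simp add: k_def)
  qed
  have inner: "(LINT x':E|lborel. cmod (K x x')) \<le> integral\<^sup>L lborel k" if x: "x \<in> E" for x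
  proof -
    have "(LINT x':E|lborel. cmod (K x x')) \<le> (\<integral>x'. k (x + (-1) * x') \<partial>lborel)"
      unfolding set_lebesgue_integral_def
    proof (rule integral_mono')
      show "integrable lborel (\<lambda>x'. k (x + (-1) * x'))"
        by (rule lborel_integrable_real_affine[OF k_int]) simp
    qed (use Kk[OF x] k0 in \<open>auto simp: indicator_def\<close>)
    also have "\<dots> = integral\<^sup>L lborel k" using lborel_integral_real_affine[of "-1" k x] by simp
    finally show ?thesis .
  qed
  have "(LINT x:E|lborel. LINT x':E|lborel. cmod (K x x')) \<le> (LINT x:E|lborel. integral\<^sup>L lborel k)"
    unfolding set_lebesgue_integral_def[of _ E "\<lambda>x. LINT x':E|lborel. cmod (K x x')"] set_lebesgue_integral_def[of _ E "\<lambda>x. integral\<^sup>L lborel k"]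
  proof (rule integral_mono')
    show "integrable lborel (\<lambda>x. indicator E x *\<^sub>R integral\<^sup>L lborel k)"
      using Efin by (intro integrable_scaleR_left) (auto simp: integrable_real_indicator)
  qed (use inner k0 in \<open>auto simp: indicator_def intro!: integral_nonneg\<close>)
  also have "\<dots> = integral\<^sup>L lborel k * measure lborel E"
    unfolding set_lebesgue_integral_def using Efin by (simp add: mult.commute)
  finally have KK: "(LINT x:E|lborel. LINT x':E|lborel. cmod (K x x')) \<le> (block_const m M R * \<Lambda> powr (1 - m / 2)) * measure lborel E"
    by (simp add: k_val)
  have "(LINT x:E|lborel. cmod (piece m (annulus \<Lambda>) g (sel x) x))\<^sup>2 \<le>
     (LINT \<xi>:annulus \<Lambda>|lborel. (cmod (g \<xi>))\<^sup>2) * (LINT x:E|lborel. LINT x':E|lborel. cmod (K x x'))"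
    using TT unfolding N_eq K_eq g_eq by (simp add: E_eq)
  also have "\<dots> \<le> (LINT \<xi>:annulus \<Lambda>|lborel. (cmod (g \<xi>))\<^sup>2) * ((block_const m M R * \<Lambda> powr (1 - m / 2)) * measure lborel E)"
    by (intro mult_left_mono KK) (auto simp: set_lebesgue_integral_def intro!: integral_nonneg)
  finally show ?thesis by (simp add: mult.assoc)
qed

text \<open>
  Splitting by a cover costs only a factor \<open>sqrt (card C)\<close>, because the blocks are disjoint in \<open>x\<close>.
\<close>
lemma cover_estimate:
  fixes F \<theta> :: "real \<Rightarrow> real"
  assumes [measurable]: "F \<in> borel_measurable borel" "\<theta> \<in> borel_measurable borel"
    and F: "\<And>x. 0 \<le> F x" "\<And>x. F x \<le> B" and A: "0 \<le> A"
    and block: "\<And>E c. E \<in> sets borel \<Longrightarrow> E \<subseteq> {-R..R} \<Longrightarrow> (\<And>x. x \<in> E \<Longrightarrow> \<theta> x \<in> {c..c + \<delta>}) \<Longrightarrow>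
       (LINT x:E|lborel. F x)\<^sup>2 \<le> A * measure lborel E"
    and C: "finite C"
  shows "E \<in> sets borel \<Longrightarrow> E \<subseteq> {-R..R} \<Longrightarrow> (\<And>x. x \<in> E \<Longrightarrow> \<exists>c\<in>C. \<theta> x \<in> {c..c + \<delta>}) \<Longrightarrow>
    (LINT x:E|lborel. F x)\<^sup>2 \<le> A * card C * measure lborel E"
  using C
proof (induction C arbitrary: E rule: finite_induct)
  case empty
  then have "E = {}" by auto
  then show ?case by (simp add: set_lebesgue_integral_def)
next
  case (insert c C)
  note [measurable] = insert.prems(1)
  \<comment> \<open>Points whose \<open>\<theta>\<close> lies in the new interval fall under the
    block bound, the others under the induction hypothesis.\<close>
  define E1 where "E1 = {x \<in> E. \<theta> x \<in> {c..c + \<delta>}}"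
  define E2 where "E2 = {x \<in> E. \<theta> x \<notin> {c..c + \<delta>}}"
  have [measurable]: "E1 \<in> sets borel" "E2 \<in> sets borel" unfolding E1_def E2_def by measurable
  have fin: "S \<in> sets borel \<Longrightarrow> S \<subseteq> E \<Longrightarrow> emeasure lborel S < \<infinity>" for S
  proof -
    assume "S \<in> sets borel" "S \<subseteq> E"
    then have "emeasure lborel S \<le> emeasure lborel {-R..R}" by (intro emeasure_mono) (use insert.prems(2) in auto)
    also have "\<dots> < \<infinity>" by (simp add: emeasure_lborel_Icc_eq)
    finally show "emeasure lborel S < \<infinity>" .
  qed
  have sub: "E1 \<subseteq> E" "E2 \<subseteq> E" and un: "E = E1 \<union> E2" "E1 \<inter> E2 = {}" by (auto simp: E1_def E2_def)
  have int: "set_integrable lborel S F" if [measurable]: "S \<in> sets borel" and "S \<subseteq> E" for S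
    unfolding set_integrable_def
  proof (rule Bochner_Integration.integrable_bound)
    show "integrable lborel (\<lambda>x. indicator S x * B)"
      using fin[OF that] by (auto simp: integrable_real_indicator)
  qed (use F order_trans[OF F] in \<open>auto simp: indicator_def\<close>)
  define I1 I2 where "I1 = (LINT x:E1|lborel. F x)" and "I2 = (LINT x:E2|lborel. F x)"
  have I: "(LINT x:E|lborel. F x) = I1 + I2"
    unfolding un(1) I1_def I2_def by (rule set_integral_Un) (use int sub un in auto)
  have me: "measure lborel E = measure lborel E1 + measure lborel E2"
    unfolding un(1) by (rule measure_Union) (use un fin[of E1] fin[of E2] sub in \<open>auto simp: less_top\<close>)
  have i1: "I1\<^sup>2 \<le> A * measure lborel E1" unfolding I1_def
    by (rule block) (use sub insert.prems in \<open>auto simp: E1_def\<close>)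
  have i2: "I2\<^sup>2 \<le> A * card C * measure lborel E2" unfolding I2_def
    by (rule insert.IH) (use sub insert.prems in \<open>auto simp: E2_def\<close>)
  have nn: "0 \<le> I1" "0 \<le> I2" unfolding I1_def I2_def set_lebesgue_integral_def
    using F by (auto intro!: Bochner_Integration.integral_nonneg)
  define n where "n = real (card C)"
  have key: "(I1 + I2)\<^sup>2 \<le> A * (1 + n) * (measure lborel E1 + measure lborel E2)"
  proof (cases "n = 0")
    case True
    then have "I2 = 0" using i2 by (simp add: n_def)
    moreover have "A * measure lborel E1 \<le> A * (measure lborel E1 + measure lborel E2)" using A by (intro mult_left_mono) auto
    ultimately show ?thesis using i1 True by simp
  next
    case False
    then have n: "n > 0" by (simp add: n_def)
    \<comment> \<open>Weighting by the number \<open>n\<close> of remaining intervals is what raises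
      the constant only from \<open>n\<close> to \<open>1 + n\<close>.\<close>
    have "0 \<le> (n * I1 - I2)\<^sup>2" by simp
    then have "n * (2 * I1 * I2) \<le> n * (n * I1\<^sup>2 + I2\<^sup>2 / n)" using n by (simp add: power2_eq_square algebra_simps)
    then have "2 * I1 * I2 \<le> n * I1\<^sup>2 + I2\<^sup>2 / n" using n by simp
    then have "(I1 + I2)\<^sup>2 \<le> (1 + n) * I1\<^sup>2 + (1 + 1 / n) * I2\<^sup>2" by (simp add: power2_eq_square algebra_simps)
    also have "\<dots> \<le> (1 + n) * (A * measure lborel E1) + (1 + 1 / n) * (A * n * measure lborel E2)"
      using i1 i2 n by (intro add_mono mult_left_mono) (auto simp: n_def)
    also have "\<dots> = A * (1 + n) * (measure lborel E1 + measure lborel E2)" using n by (simp add: field_simps)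
    finally show ?thesis .
  qed
  then show ?case using insert.hyps by (simp add: I me n_def)
qed

text \<open>The maximiser is updated one parameter at a time, each comparison cutting along a Borel
  set. Measurability of the attained maximum is carried through the induction because the next
  comparison needs it.\<close>

lemma finite_max_selection:
  fixes f :: "'a :: topological_space \<Rightarrow> real \<Rightarrow> real"
  assumes "finite G" "G \<noteq> {}" "\<And>p. p \<in> G \<Longrightarrow> f p \<in> borel_measurable borel"
  shows "\<exists>sel. sel \<in> borel \<rightarrow>\<^sub>M borel \<and> (\<lambda>x. f (sel x) x) \<in> borel_measurable borel \<and>
    (\<forall>x. sel x \<in> G \<and> (\<forall>p\<in>G. f p x \<le> f (sel x) x))"
  using assms
proof (induction G rule: finite_ne_induct)
  case (singleton p)
  then show ?case by (intro exI[of _ "\<lambda>_. p"]) auto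
next
  case (insert p G)
  then obtain sel where [measurable]: "sel \<in> borel \<rightarrow>\<^sub>M borel" "(\<lambda>x. f (sel x) x) \<in> borel_measurable borel"
    and sel: "\<And>x. sel x \<in> G" "\<And>x q. q \<in> G \<Longrightarrow> f q x \<le> f (sel x) x" by auto
  have [measurable]: "f p \<in> borel_measurable borel" using insert by auto
  define sel' where "sel' x = (if f (sel x) x \<le> f p x then p else sel x)" for x
  have [measurable]: "sel' \<in> borel \<rightarrow>\<^sub>M borel" unfolding sel'_def by measurable
  have "(\<lambda>x. f (sel' x) x) = (\<lambda>x. if f (sel x) x \<le> f p x then f p x else f (sel x) x)"
    by (auto simp: sel'_def)
  then have [measurable]: "(\<lambda>x. f (sel' x) x) \<in> borel_measurable borel" by simp
  show ?case
  proof (intro exI[of _ sel'] conjI allI)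
    fix x
    show "sel' x \<in> insert p G" "\<forall>q\<in>insert p G. f q x \<le> f (sel' x) x"
      using sel by (auto simp: sel'_def intro: order_trans less_imp_le)
  qed measurable
qed

section \<open>Finite nets of parameters and the maximal function of a dyadic piece\<close>

lemma continuous_on_symbol:
  assumes "0 < m"
  shows "continuous_on S (\<lambda>z. symbol m (fst z) (snd z))"
  unfolding symbol_def using assms
  by (intro continuous_intros continuous_on_cis continuous_on_powr') auto

text \<open>Uniform continuity on the compact product of \<open>P\<close> and \<open>{-b..b}\<close>
  yields one modulus for all frequencies up to \<open>b\<close>.\<close>

lemma symbol_equicontinuous:
  assumes m: "0 < m" and P: "compact P" and \<epsilon>: "0 < \<epsilon>"
  obtains d where "0 < d"
    and "\<And>p q \<xi>. p \<in> P \<Longrightarrow> q \<in> P \<Longrightarrow> dist p q < d \<Longrightarrow> \<bar>\<xi>\<bar> \<le> b \<Longrightarrow> cmod (symbol m p \<xi> - symbol m q \<xi>) \<le> \<epsilon>"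
proof -
  have "uniformly_continuous_on (P \<times> {-b..b}) (\<lambda>z. symbol m (fst z) (snd z))"
    by (intro compact_uniformly_continuous continuous_on_symbol m compact_Times P compact_Icc)
  then obtain d where d: "d > 0" and
    close: "\<And>z z'. z \<in> P \<times> {-b..b} \<Longrightarrow> z' \<in> P \<times> {-b..b} \<Longrightarrow> dist z' z < d \<Longrightarrow>
      dist (symbol m (fst z') (snd z')) (symbol m (fst z) (snd z)) < \<epsilon>"
    unfolding uniformly_continuous_on_def using \<epsilon> by metis
  show ?thesis
  proof (rule that[OF d])
    fix p q \<xi> assume "p \<in> P" "q \<in> P" "dist p q < d" "\<bar>\<xi>\<bar> \<le> b"
    then show "cmod (symbol m p \<xi> - symbol m q \<xi>) \<le> \<epsilon>"
      using close[of "(q, \<xi>)" "(p, \<xi>)"] by (auto simp: dist_Pair_Pair dist_norm abs_le_iff less_imp_le)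
  qed
qed

text \<open>Total boundedness of \<open>P\<close> replaces the supremum over \<open>P\<close> by a
  maximum over finitely many parameters, to which the measurable selection applies.\<close>

lemma symbol_net:
  assumes m: "0 < m" and P: "compact P" and \<epsilon>: "0 < \<epsilon>"
  shows "\<exists>G. finite G \<and> G \<subseteq> P \<and> (\<forall>p\<in>P. \<exists>q\<in>G. \<forall>\<xi>. \<bar>\<xi>\<bar> \<le> b \<longrightarrow> cmod (symbol m p \<xi> - symbol m q \<xi>) \<le> \<epsilon>)"
proof -
  obtain d where d: "d > 0" and
    close: "\<And>p q \<xi>. p \<in> P \<Longrightarrow> q \<in> P \<Longrightarrow> dist p q < d \<Longrightarrow> \<bar>\<xi>\<bar> \<le> b \<Longrightarrow> cmod (symbol m p \<xi> - symbol m q \<xi>) \<le> \<epsilon>"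
    using symbol_equicontinuous[OF assms] by metis
  obtain G where G: "finite G" "G \<subseteq> P" "P \<subseteq> (\<Union>x\<in>G. ball x d)"
    using seq_compact_imp_totally_bounded[OF P[THEN compact_imp_seq_compact]] d by metis
  show ?thesis
  proof (intro exI[of _ G] conjI ballI G(1,2))
    fix p assume p: "p \<in> P"
    then obtain q where q: "q \<in> G" "dist p q < d" using G(3) by (auto simp: dist_commute)
    show "\<exists>q\<in>G. \<forall>\<xi>. \<bar>\<xi>\<bar> \<le> b \<longrightarrow> cmod (symbol m p \<xi> - symbol m q \<xi>) \<le> \<epsilon>"
      using close[OF p _ q(2)] q(1) G(2) by (intro bexI[of _ q]) auto
  qed
qed

lemma piece_bound:
  assumes [measurable]: "J \<in> sets borel" and g: "set_integrable lborel J g" and p: "0 \<le> snd (snd p)"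
  shows "cmod (piece m J g p x) \<le> (LINT \<xi>:J|lborel. cmod (g \<xi>))"
  unfolding piece_def set_lebesgue_integral_def
proof (rule integral_norm_le)
  show "integrable lborel (\<lambda>\<xi>. indicat_real J \<xi> *\<^sub>R cmod (g \<xi>))"
    using integrable_norm[OF g[unfolded set_integrable_def]] by simp
  show "cmod (indicat_real J \<xi> *\<^sub>R (cis (x * \<xi>) * symbol m p \<xi> * g \<xi>)) \<le> indicat_real J \<xi> *\<^sub>R cmod (g \<xi>)" for \<xi>
    using norm_symbol[OF p] by (auto simp: norm_mult indicator_def intro!: mult_left_le_one_le)
qed

lemma piece_integrable:
  assumes g: "set_integrable lborel J g" and p: "0 \<le> snd (snd p)"
  shows "integrable lborel (\<lambda>\<xi>. indicat_real J \<xi> *\<^sub>R (cis (x * \<xi>) * symbol m p \<xi> * g \<xi>))"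
proof -
  have eq: "indicat_real J \<xi> *\<^sub>R (cis (x * \<xi>) * symbol m p \<xi> * g \<xi>) = cis (x * \<xi>) * symbol m p \<xi> * (indicat_real J \<xi> *\<^sub>R g \<xi>)" for \<xi>
    by (simp add: scaleR_conv_of_real)
  have [measurable]: "(\<lambda>\<xi>. indicat_real J \<xi> *\<^sub>R g \<xi>) \<in> borel_measurable borel"
    using g[unfolded set_integrable_def] by (auto dest: borel_measurable_integrable)
  show ?thesis
    unfolding eq
  proof (rule Bochner_Integration.integrable_bound[OF g[unfolded set_integrable_def]])
    show "AE \<xi> in lborel. norm (cis (x * \<xi>) * symbol m p \<xi> * (indicat_real J \<xi> *\<^sub>R g \<xi>)) \<le> norm (indicat_real J \<xi> *\<^sub>R g \<xi>)"
      using norm_symbol[OF p] by (auto simp: norm_mult indicator_def mult_left_le_one_le)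
  qed measurable
qed

lemma piece_diff:
  assumes g: "set_integrable lborel J g"
    and p: "0 \<le> snd (snd p)" "0 \<le> snd (snd q)"
    and close: "\<And>\<xi>. \<xi> \<in> J \<Longrightarrow> cmod (symbol m p \<xi> - symbol m q \<xi>) \<le> \<epsilon>"
  shows "cmod (piece m J g p x - piece m J g q x) \<le> \<epsilon> * (LINT \<xi>:J|lborel. cmod (g \<xi>))"
proof -
  have "piece m J g p x - piece m J g q x = (LINT \<xi>|lborel. indicat_real J \<xi> *\<^sub>R (cis (x * \<xi>) * symbol m p \<xi> * g \<xi>) - indicat_real J \<xi> *\<^sub>R (cis (x * \<xi>) * symbol m q \<xi> * g \<xi>))"
    unfolding piece_def set_lebesgue_integral_def
    by (subst Bochner_Integration.integral_diff) (use piece_integrable[OF g] p in auto)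
  also have "cmod \<dots> \<le> (LINT \<xi>|lborel. \<epsilon> * (indicat_real J \<xi> *\<^sub>R cmod (g \<xi>)))"
  proof (rule integral_norm_le)
    show "integrable lborel (\<lambda>\<xi>. \<epsilon> * (indicat_real J \<xi> *\<^sub>R cmod (g \<xi>)))"
      using integrable_norm[OF g[unfolded set_integrable_def]] by simp
    fix \<xi>
    have "cmod (cis (x * \<xi>) * symbol m p \<xi> * g \<xi> - cis (x * \<xi>) * symbol m q \<xi> * g \<xi>) \<le> \<epsilon> * cmod (g \<xi>)" if "\<xi> \<in> J"
    proof -
      have "cis (x * \<xi>) * symbol m p \<xi> * g \<xi> - cis (x * \<xi>) * symbol m q \<xi> * g \<xi> = cis (x * \<xi>) * ((symbol m p \<xi> - symbol m q \<xi>) * g \<xi>)"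
        by (simp add: algebra_simps)
      then show ?thesis using close[OF that] by (simp add: norm_mult mult_right_mono)
    qed
    then show "cmod (indicat_real J \<xi> *\<^sub>R (cis (x * \<xi>) * symbol m p \<xi> * g \<xi>) - indicat_real J \<xi> *\<^sub>R (cis (x * \<xi>) * symbol m q \<xi> * g \<xi>))
      \<le> \<epsilon> * (indicat_real J \<xi> *\<^sub>R cmod (g \<xi>))"
      by (auto simp: indicator_def)
  qed
  finally show ?thesis by (simp add: set_lebesgue_integral_def)
qed

text \<open>The majorant is the maximum over a finite net plus \<open>\<eta>\<close>; this avoids
  any question of measurability for the full supremum. The net maximum is linearised by
  \<open>sel\<close> and estimated by \<open>cover_estimate\<close> on \<open>{-R..R}\<close>, whose
  measure is \<open>2 * R\<close>.\<close>

lemma dyadic_majorant: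
  fixes m \<Lambda> M R \<eta> :: real and \<Theta> C :: "real set"
  defines "P \<equiv> \<Theta> \<times> {-1..1} \<times> {0..1}"
  assumes m: "0 < m" "m < 1" and \<Lambda>: "1 \<le> \<Lambda>" and R: "0 \<le> R" and \<eta>: "0 < \<eta>"
    and \<Theta>: "compact \<Theta>" "\<Theta> \<noteq> {}" "\<And>\<theta>. \<theta> \<in> \<Theta> \<Longrightarrow> \<bar>\<theta>\<bar> \<le> M"
    and C: "finite C" "\<Theta> \<subseteq> (\<Union>c\<in>C. {c..c + \<Lambda> powr (- m / 2)})"
    and g [measurable]: "g \<in> borel_measurable borel"
    and g1: "set_integrable lborel (annulus \<Lambda>) g"
    and g2: "set_integrable lborel (annulus \<Lambda>) (\<lambda>\<xi>. (cmod (g \<xi>))\<^sup>2)"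
  shows "\<exists>Mj. Mj \<in> borel_measurable borel \<and> (\<forall>x. 0 \<le> Mj x) \<and>
    (\<forall>x. \<forall>p\<in>P. cmod (piece m (annulus \<Lambda>) g p x) \<le> Mj x) \<and>
    (\<integral>\<^sup>+x\<in>{-R..R}. ennreal (Mj x) \<partial>lborel) \<le>
      ennreal (sqrt ((LINT \<xi>:annulus \<Lambda>|lborel. (cmod (g \<xi>))\<^sup>2) * (block_const m M R * \<Lambda> powr (1 - m / 2))
         * card C * (2 * R)) + 2 * R * \<eta>)"
proof -
  have M: "0 \<le> M" using \<Theta> by (metis abs_ge_zero all_not_in_conv order_trans)
  define B where "B = (LINT \<xi>:annulus \<Lambda>|lborel. cmod (g \<xi>))"
  have B: "B \<ge> 0" unfolding B_def set_lebesgue_integral_def by (rule Bochner_Integration.integral_nonneg) auto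
  \<comment> \<open>Chosen so that \<open>\<epsilon> * B \<le> \<eta>\<close>; the added 1 covers
    the case \<open>B = 0\<close>.\<close>
  define \<epsilon> where "\<epsilon> = \<eta> / (B + 1)"
  have \<epsilon>: "\<epsilon> > 0" using \<eta> B by (simp add: \<epsilon>_def)
  have \<epsilon>B: "\<epsilon> * B \<le> \<eta>" using \<eta> B by (simp add: \<epsilon>_def field_simps)
  have P: "compact P" unfolding P_def by (intro compact_Times \<Theta>(1) compact_Icc)
  have Pne: "P \<noteq> {}" using \<Theta>(2) unfolding P_def by auto
  obtain G where G: "finite G" "G \<subseteq> P"
    "\<And>p. p \<in> P \<Longrightarrow> \<exists>q\<in>G. \<forall>\<xi>. \<bar>\<xi>\<bar> \<le> 2 * \<Lambda> \<longrightarrow> cmod (symbol m p \<xi> - symbol m q \<xi>) \<le> \<epsilon>"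
    using symbol_net[OF m(1) P \<epsilon>, of "2 * \<Lambda>"] by auto
  have Gne: "G \<noteq> {}" using Pne G(3) by auto
  obtain sel where sel [measurable]: "sel \<in> borel \<rightarrow>\<^sub>M borel"
    and selG: "\<And>x. sel x \<in> G" and selmax: "\<And>x p. p \<in> G \<Longrightarrow> cmod (piece m (annulus \<Lambda>) g p x) \<le> cmod (piece m (annulus \<Lambda>) g (sel x) x)"
    using finite_max_selection[OF G(1) Gne, of "\<lambda>p x. cmod (piece m (annulus \<Lambda>) g p x)"] by auto
  have selP: "sel x \<in> P" for x using selG G(2) by auto
  define F where "F x = cmod (piece m (annulus \<Lambda>) g (sel x) x)" for x
  have [measurable]: "F \<in> borel_measurable borel" unfolding F_def by measurable
  have FB: "0 \<le> F x" "F x \<le> B" for x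
    using selP[of x] by (auto simp: F_def B_def P_def intro!: piece_bound g1)
  define A where "A = (LINT \<xi>:annulus \<Lambda>|lborel. (cmod (g \<xi>))\<^sup>2) * (block_const m M R * \<Lambda> powr (1 - m / 2))"
  have A: "A \<ge> 0" unfolding A_def
    using block_const_pos[OF m M, of R]
    by (auto simp: set_lebesgue_integral_def intro!: Bochner_Integration.integral_nonneg mult_nonneg_nonneg)
  have "fst \<in> borel_measurable (borel :: (real \<times> real \<times> real) measure)"
    by (auto intro!: borel_measurable_continuous_onI continuous_intros)
  then have [measurable]: "(\<lambda>x. fst (sel x)) \<in> borel_measurable borel" by measurable
  have "(LINT x:{-R..R}|lborel. F x)\<^sup>2 \<le> A * card C * measure lborel {-R..R}"
  proof (rule cover_estimate[where \<theta> = "\<lambda>x. fst (sel x)" and B = B and R = R and \<delta> = "\<Lambda> powr (- m / 2)"])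
    fix E c assume E: "E \<in> sets borel" "E \<subseteq> {-R..R}" "\<And>x. x \<in> E \<Longrightarrow> fst (sel x) \<in> {c..c + \<Lambda> powr (- m / 2)}"
    have "\<bar>fst (sel x)\<bar> \<le> M" "\<bar>fst (snd (sel x))\<bar> \<le> 1" "0 \<le> snd (snd (sel x))" for x
      using selP[of x] \<Theta>(3) by (auto simp: P_def)
    then show "(LINT x:E|lborel. F x)\<^sup>2 \<le> A * measure lborel E"
      unfolding F_def A_def by (intro block_estimate[where c=c] m \<Lambda> M sel E g g2)
  next
    fix x show "\<exists>c\<in>C. fst (sel x) \<in> {c..c + \<Lambda> powr (- m / 2)}"
      using selP[of x] subsetD[OF C(2), of "fst (sel x)"] by (auto simp: P_def)
  qed (use FB A C in auto)
  then have "\<bar>LINT x:{-R..R}|lborel. F x\<bar> \<le> sqrt (A * card C * (2 * R))"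
    using R by (intro real_le_rsqrt) (simp add: power2_abs)
  then have int: "(LINT x:{-R..R}|lborel. F x) \<le> sqrt (A * card C * (2 * R))" by linarith
  have "(\<integral>\<^sup>+x\<in>{-R..R}. ennreal (F x + \<eta>) \<partial>lborel) = ennreal (LINT x|lborel. indicator {-R..R} x * (F x + \<eta>))"
  proof (subst nn_integral_eq_integral[symmetric])
    show "integrable lborel (\<lambda>x. indicat_real {- R..R} x * (F x + \<eta>))"
    proof (rule Bochner_Integration.integrable_bound)
      show "integrable lborel (\<lambda>x. indicator {-R..R} x * (B + \<eta>))"
        by (intro integrable_mult_left integrable_real_indicator) (auto simp: emeasure_lborel_Icc_eq)
      have "\<bar>F x + \<eta>\<bar> \<le> \<bar>B + \<eta>\<bar>" for x using FB[of x] \<eta> by linarith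
      then show "AE x in lborel. norm (indicat_real {- R..R} x * (F x + \<eta>)) \<le> norm (indicat_real {- R..R} x * (B + \<eta>))"
        by (simp add: indicator_def)
    qed measurable
    show "AE x in lborel. 0 \<le> indicat_real {- R..R} x * (F x + \<eta>)" using FB \<eta> by (auto simp: indicator_def add_nonneg_nonneg)
    show "(\<integral>\<^sup>+x\<in>{-R..R}. ennreal (F x + \<eta>) \<partial>lborel) = (\<integral>\<^sup>+x. ennreal (indicat_real {- R..R} x * (F x + \<eta>)) \<partial>lborel)"
      by (rule nn_integral_cong) (auto simp: indicator_def)
  qed
  also have "(LINT x|lborel. indicator {-R..R} x * (F x + \<eta>)) = (LINT x:{-R..R}|lborel. F x) + 2 * R * \<eta>"
  proof -
    have i1: "integrable lborel (\<lambda>x. indicat_real {- R..R} x * F x)"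
    proof (rule Bochner_Integration.integrable_bound)
      show "integrable lborel (\<lambda>x. indicator {-R..R} x * B)"
        by (intro integrable_mult_left integrable_real_indicator) (auto simp: emeasure_lborel_Icc_eq)
      have "\<bar>F x\<bar> \<le> \<bar>B\<bar>" for x using FB[of x] by linarith
      then show "AE x in lborel. norm (indicat_real {- R..R} x * F x) \<le> norm (indicat_real {- R..R} x * B)"
        by (simp add: indicator_def)
    qed measurable
    have i2: "integrable lborel (\<lambda>x. indicator {-R..R} x * \<eta>)"
        by (intro integrable_mult_left integrable_real_indicator) (auto simp: emeasure_lborel_Icc_eq)
    show ?thesis unfolding set_lebesgue_integral_def distrib_left
      by (subst Bochner_Integration.integral_add[OF i1 i2]) (use R in simp)
  qed
  finally have nn: "(\<integral>\<^sup>+x\<in>{-R..R}. ennreal (F x + \<eta>) \<partial>lborel) \<le> ennreal (sqrt (A * card C * (2 * R)) + 2 * R * \<eta>)"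
    using int by (simp add: ennreal_leI)
  show ?thesis
  proof (intro exI[of _ "\<lambda>x. F x + \<eta>"] conjI allI ballI)
    fix x p assume p: "p \<in> P"
    then obtain q where q: "q \<in> G" "\<And>\<xi>. \<bar>\<xi>\<bar> \<le> 2 * \<Lambda> \<Longrightarrow> cmod (symbol m p \<xi> - symbol m q \<xi>) \<le> \<epsilon>"
      using G(3) by metis
    have "cmod (piece m (annulus \<Lambda>) g p x - piece m (annulus \<Lambda>) g q x) \<le> \<epsilon> * B" unfolding B_def
      by (rule piece_diff[OF g1]) (use p q G(2) in \<open>auto simp: P_def annulus_def\<close>)
    then have "cmod (piece m (annulus \<Lambda>) g p x) \<le> cmod (piece m (annulus \<Lambda>) g q x) + \<eta>"
      using \<epsilon>B norm_triangle_ineq2[of "piece m (annulus \<Lambda>) g p x" "piece m (annulus \<Lambda>) g q x"] by linarith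
    then show "cmod (piece m (annulus \<Lambda>) g p x) \<le> F x + \<eta>"
      using selmax[OF q(1), of x] unfolding F_def by linarith
  qed (use nn FB \<eta> in \<open>auto simp: A_def add_nonneg_nonneg\<close>)
qed

section \<open>Summation over the dyadic pieces\<close>

lemma integrable_exp_minus_abs:
  assumes a: "0 < a"
  shows "integrable lborel (\<lambda>u::real. exp (- (a * \<bar>u\<bar>)))"
proof -
  define k where "k u = indicator {0..} u *\<^sub>R exp (- a * u)" for u :: real
  have "(\<lambda>u. exp (- a * u)) integrable_on {0..}"
    using integrable_on_exp_minus_to_infinity[OF a] .
  then have "(\<lambda>u. exp (- a * u)) absolutely_integrable_on {0..}"
    by (rule nonnegative_absolutely_integrable_1) auto
  then have "integrable lebesgue k"
    by (simp add: set_integrable_def k_def[abs_def])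
  then have k: "integrable lborel k"
    by (subst (asm) integrable_completion) (auto simp: k_def[abs_def])
  then have "integrable lborel (\<lambda>u. k u + k (0 + (-1) * u))"
    by (intro Bochner_Integration.integrable_add lborel_integrable_real_affine) auto
  then show ?thesis
    by (rule Bochner_Integration.integrable_bound) (auto simp: k_def indicator_def)
qed

text \<open>The product of two square-integrable functions is dominated by the sum of their squares.
  The squared Gaussian is in turn dominated by an exponential in \<open>\<bar>\<xi>\<bar>\<close>,
  because \<open>\<bar>\<xi>\<bar> \<le> \<xi>\<^sup>2 + 1\<close>.\<close>

lemma integrable_times_gaussian:
  fixes g :: "real \<Rightarrow> complex"
  assumes [measurable]: "g \<in> borel_measurable borel" and g2: "integrable lborel (\<lambda>\<xi>. (cmod (g \<xi>))\<^sup>2)"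
    and \<mu>: "0 < snd (snd p)"
  shows "integrable lborel (\<lambda>\<xi>. cis (x * \<xi>) * symbol m p \<xi> * g \<xi>)"
proof -
  define \<mu> where "\<mu> = snd (snd p)"
  have "integrable lborel (\<lambda>\<xi>. (cmod (g \<xi>))\<^sup>2 + exp (2 * \<mu>) * exp (- (2 * \<mu> * \<bar>\<xi>\<bar>)))"
    using \<mu> by (intro Bochner_Integration.integrable_add g2 integrable_mult_right integrable_exp_minus_abs) (simp add: \<mu>_def)
  then show ?thesis
  proof (rule Bochner_Integration.integrable_bound)
    show "AE \<xi> in lborel. norm (cis (x * \<xi>) * symbol m p \<xi> * g \<xi>) \<le>
        norm ((cmod (g \<xi>))\<^sup>2 + exp (2 * \<mu>) * exp (- (2 * \<mu> * \<bar>\<xi>\<bar>)))"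
    proof (rule AE_I2)
      fix \<xi> :: real
      define e where "e = exp (- (\<mu> * \<xi>\<^sup>2))"
      have "2 * \<bar>\<xi>\<bar> \<le> \<xi>\<^sup>2 + 1" using sum_squares_bound[of "\<bar>\<xi>\<bar>" 1] by simp
      then have "\<bar>\<xi>\<bar> \<le> \<xi>\<^sup>2 + 1" by linarith
      then have "\<mu> * \<bar>\<xi>\<bar> \<le> \<mu> * (\<xi>\<^sup>2 + 1)" using \<mu> by (intro mult_left_mono) (auto simp: \<mu>_def)
      then have "e\<^sup>2 \<le> exp (2 * \<mu>) * exp (- (2 * \<mu> * \<bar>\<xi>\<bar>))"
        unfolding e_def power2_eq_square exp_add[symmetric] by (simp add: algebra_simps)
      moreover have "e * cmod (g \<xi>) \<le> (cmod (g \<xi>))\<^sup>2 + e\<^sup>2"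
        proof -
        have "0 \<le> e * cmod (g \<xi>)" by (simp add: e_def)
        then show ?thesis using sum_squares_bound[of e "cmod (g \<xi>)"] by linarith
      qed
      ultimately show "norm (cis (x * \<xi>) * symbol m p \<xi> * g \<xi>) \<le>
        norm ((cmod (g \<xi>))\<^sup>2 + exp (2 * \<mu>) * exp (- (2 * \<mu> * \<bar>\<xi>\<bar>)))"
        by (simp add: norm_mult symbol_def \<mu>_def e_def)
    qed
  qed measurable
qed

text \<open>The index is shifted by one to make room for the low frequencies at 0, so
  \<open>shell (Suc j)\<close> is \<open>annulus (2 ^ j)\<close>.\<close>

definition shell :: "nat \<Rightarrow> real set" where
  "shell j = (if j = 0 then {\<xi>. \<bar>\<xi>\<bar> < 1} else annulus (2 ^ (j - 1)))"

lemma shell_measurable [measurable]: "shell j \<in> sets borel"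
proof -
  have "{\<xi>::real. \<bar>\<xi>\<bar> < 1} \<in> sets borel" by measurable
  then show ?thesis by (simp add: shell_def annulus_measurable)
qed

lemma shell_eq: "shell j = {\<xi>. (if j = 0 then 0 else 2 ^ (j - 1)) \<le> \<bar>\<xi>\<bar> \<and> \<bar>\<xi>\<bar> < 2 ^ j}"
  by (cases j) (auto simp: shell_def annulus_def)

lemma shell_disjoint: "i \<noteq> j \<Longrightarrow> shell i \<inter> shell j = {}"
proof -
  have *: "shell i \<inter> shell j = {}" if "i < j" for i j
  proof -
    have le: "(2::real) ^ i \<le> 2 ^ (j - 1)" using that by (intro power_increasing) auto
    show ?thesis
    proof (rule equals0I)
      fix \<xi> assume "\<xi> \<in> shell i \<inter> shell j"
      then have "\<bar>\<xi>\<bar> < 2 ^ i" "2 ^ (j - 1) \<le> \<bar>\<xi>\<bar>" using that by (auto simp: shell_eq)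
      with le show False by linarith
    qed
  qed
  show "i \<noteq> j \<Longrightarrow> shell i \<inter> shell j = {}" using *[of i j] *[of j i] by (cases "i < j") auto
qed

lemma UN_shell: "(\<Union>j. shell j) = UNIV"
proof safe
  fix \<xi> :: real
  define j where "j = (LEAST j::nat. \<bar>\<xi>\<bar> < 2 ^ j)"
  obtain n where "\<bar>\<xi>\<bar> < 2 ^ n" using real_arch_pow[of 2 "\<bar>\<xi>\<bar>"] by auto
  then have "\<bar>\<xi>\<bar> < 2 ^ j" unfolding j_def by (rule LeastI)
  moreover have "2 ^ (j - 1) \<le> \<bar>\<xi>\<bar>" if "j \<noteq> 0"
    using not_less_Least[of "j - 1" "\<lambda>j. \<bar>\<xi>\<bar> < 2 ^ j"] that by (auto simp: j_def[symmetric])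
  ultimately show "\<xi> \<in> (\<Union>j. shell j)" by (auto simp: shell_eq intro!: exI[of _ j])
qed simp

text \<open>Countable additivity over the disjoint shells needs absolute integrability, which the
  strictly positive damping supplies. At damping 0 only the sum on the right is used.\<close>

lemma piece_shell_suminf:
  assumes [measurable]: "g \<in> borel_measurable borel" and g2: "integrable lborel (\<lambda>\<xi>. (cmod (g \<xi>))\<^sup>2)"
    and \<mu>: "0 < snd (snd p)"
  shows "(LINT \<xi>|lborel. cis (x * \<xi>) * symbol m p \<xi> * g \<xi>) = (\<Sum>j. piece m (shell j) g p x)"
proof -
  have "(LINT \<xi>:(\<Union>j. shell j)|lborel. cis (x * \<xi>) * symbol m p \<xi> * g \<xi>) = (\<Sum>j. piece m (shell j) g p x)"
    unfolding piece_def
    by (rule lebesgue_integral_countable_add)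
       (use integrable_times_gaussian[OF assms] in \<open>auto simp: shell_disjoint UN_shell set_integrable_def\<close>)
  then show ?thesis by (simp add: UN_shell set_lebesgue_integral_def)
qed

text \<open>Shells are bounded, so square integrability gives integrability through
  \<open>cmod (g \<xi>) \<le> (cmod (g \<xi>))\<^sup>2 + 1\<close>.\<close>

lemma shell_integrable:
  assumes [measurable]: "g \<in> borel_measurable borel" and g2: "integrable lborel (\<lambda>\<xi>. (cmod (g \<xi>))\<^sup>2)"
  shows "set_integrable lborel (shell j) g" "set_integrable lborel (shell j) (\<lambda>\<xi>. (cmod (g \<xi>))\<^sup>2)"
proof -
  show "set_integrable lborel (shell j) (\<lambda>\<xi>. (cmod (g \<xi>))\<^sup>2)"
    unfolding set_integrable_def by (rule integrable_mult_indicator[OF _ g2]) simp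
  have "integrable lborel (\<lambda>\<xi>. (cmod (g \<xi>))\<^sup>2 + indicator {- (2 ^ j)..2 ^ j} \<xi>)"
    by (intro Bochner_Integration.integrable_add g2 integrable_real_indicator) (auto simp: emeasure_lborel_Icc_eq)
  then show "set_integrable lborel (shell j) g"
    unfolding set_integrable_def
  proof (rule Bochner_Integration.integrable_bound)
    have *: "cmod (g \<xi>) \<le> (cmod (g \<xi>))\<^sup>2 + 1" for \<xi> using sum_squares_bound[of "cmod (g \<xi>)" 1] by (simp add: power2_eq_square) (smt (verit) norm_ge_zero)
    show "AE \<xi> in lborel. norm (indicat_real (shell j) \<xi> *\<^sub>R g \<xi>) \<le> norm ((cmod (g \<xi>))\<^sup>2 + indicat_real {- (2 ^ j)..2 ^ j} \<xi>)"
    proof (rule AE_I2)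
      fix \<xi>
      show "norm (indicat_real (shell j) \<xi> *\<^sub>R g \<xi>) \<le> norm ((cmod (g \<xi>))\<^sup>2 + indicat_real {- (2 ^ j)..2 ^ j} \<xi>)"
      proof (cases "\<xi> \<in> shell j")
        case True
        then have "\<xi> \<in> {- (2 ^ j)..2 ^ j}" by (auto simp: shell_eq)
        then show ?thesis using True *[of \<xi>] by simp
      qed simp
    qed
  qed measurable
qed

lemma continuous_on_piece:
  assumes m: "0 < m" and P: "compact P" "\<And>p. p \<in> P \<Longrightarrow> 0 \<le> snd (snd p)"
    and g: "set_integrable lborel (shell j) g"
  shows "continuous_on P (\<lambda>p. piece m (shell j) g p x)"
  unfolding continuous_on_iff
proof (intro ballI allI impI)
  fix p e assume p: "p \<in> P" and e: "0 < (e::real)"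
  define B where "B = (LINT \<xi>:shell j|lborel. cmod (g \<xi>))"
  have B: "B \<ge> 0" unfolding B_def set_lebesgue_integral_def by (rule Bochner_Integration.integral_nonneg) auto
  define \<epsilon> where "\<epsilon> = e / (B + 1)"
  have \<epsilon>: "\<epsilon> > 0" using e B by (simp add: \<epsilon>_def)
  have \<epsilon>B: "\<epsilon> * B < e" using e B by (simp add: \<epsilon>_def field_simps)
  obtain d where d: "0 < d" and close: "\<And>p q \<xi>. p \<in> P \<Longrightarrow> q \<in> P \<Longrightarrow> dist p q < d \<Longrightarrow> \<bar>\<xi>\<bar> \<le> 2 ^ j \<Longrightarrow> cmod (symbol m p \<xi> - symbol m q \<xi>) \<le> \<epsilon>"
    using symbol_equicontinuous[OF m P(1) \<epsilon>] by metis
  show "\<exists>d>0. \<forall>q\<in>P. dist q p < d \<longrightarrow> dist (piece m (shell j) g q x) (piece m (shell j) g p x) < e"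
  proof (intro exI[of _ d] conjI ballI impI d)
    fix q assume q: "q \<in> P" "dist q p < d"
    have "cmod (piece m (shell j) g q x - piece m (shell j) g p x) \<le> \<epsilon> * B" unfolding B_def
      by (rule piece_diff[OF g P(2)[OF q(1)] P(2)[OF p]], rule close[OF q(1) p q(2)]) (auto simp: shell_eq)
    then show "dist (piece m (shell j) g q x) (piece m (shell j) g p x) < e" using \<epsilon>B by (simp add: dist_norm)
  qed
qed

text \<open>The majorants of the shells have integrals over \<open>{-R..R}\<close> bounded by a
  geometric series, so their sum is finite almost everywhere. At such a point the Weierstrass test
  gives uniform convergence on \<open>P\<close>, and every piece is continuous in the
  parameter.\<close>

lemma evolution_sum_continuous_AE:
  fixes m s r K :: real and \<Theta> :: "real set"
  defines "P \<equiv> \<Theta> \<times> {-1..1} \<times> {0..1}"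
  assumes m: "0 < m" "m < 1" and r: "0 \<le> r" and s: "s > 1/2 - m/4 + m * r / 4"
    and \<Theta>: "compact \<Theta>" "\<Theta> \<noteq> {}"
    and cover: "\<And>j::nat. \<exists>C. finite C \<and> \<Theta> \<subseteq> (\<Union>c\<in>C. {c..c + (2 ^ j) powr (- m / 2)}) \<and> card C \<le> K * (2 ^ j) powr (m * r / 2)"
    and g [measurable]: "g \<in> borel_measurable borel"
    and gs: "integrable lborel (\<lambda>\<xi>. (1 + \<xi>\<^sup>2) powr s * (cmod (g \<xi>))\<^sup>2)"
    and g2: "integrable lborel (\<lambda>\<xi>. (cmod (g \<xi>))\<^sup>2)"
  shows "AE x in lborel. continuous_on P (\<lambda>p. \<Sum>j. piece m (shell j) g p x)"
proof -
  have "s > 0"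
  proof -
    have "0 \<le> m * r / 4" using m r by simp
    then show ?thesis using s m by linarith
  qed
  obtain M where M: "\<And>\<theta>. \<theta> \<in> \<Theta> \<Longrightarrow> \<bar>\<theta>\<bar> \<le> M"
    using compact_imp_bounded[OF \<Theta>(1)] unfolding bounded_iff real_norm_def by metis
  have M0: "M \<ge> 0" using M \<Theta>(2) by (metis abs_ge_zero all_not_in_conv order_trans)
  have cP: "compact P" unfolding P_def by (intro compact_Times \<Theta>(1) compact_Icc)
  obtain C where C: "\<And>j. finite (C j)" "\<And>j. \<Theta> \<subseteq> (\<Union>c\<in>C j. {c..c + (2 ^ j) powr (- m / 2)})"
    "\<And>j::nat. card (C j) \<le> K * (2 ^ j) powr (m * r / 2)"
    using cover by metis
  have K: "K \<ge> 0" using C(3)[of 0] of_nat_0_le_iff order_trans by fastforce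
  define W where "W = (LINT \<xi>|lborel. (1 + \<xi>\<^sup>2) powr s * (cmod (g \<xi>))\<^sup>2)"
  have W: "W \<ge> 0" unfolding W_def by (rule Bochner_Integration.integral_nonneg) auto
  have annulus_shell: "annulus (2 ^ j) = shell (Suc j)" for j by (simp add: shell_def)
  \<comment> \<open>On this annulus the Sobolev weight is at least
    \<open>(2 ^ j) powr (2 * s)\<close>.\<close>
  have G: "(LINT \<xi>:annulus (2 ^ j)|lborel. (cmod (g \<xi>))\<^sup>2) \<le> (2 ^ j) powr (- 2 * s) * W" for j :: nat
  proof -
    have "(LINT \<xi>:annulus (2 ^ j)|lborel. (cmod (g \<xi>))\<^sup>2) \<le> (LINT \<xi>|lborel. (2 ^ j) powr (- 2 * s) * ((1 + \<xi>\<^sup>2) powr s * (cmod (g \<xi>))\<^sup>2))"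
      unfolding set_lebesgue_integral_def
    proof (rule integral_mono')
      show "integrable lborel (\<lambda>\<xi>. (2 ^ j) powr (- 2 * s) * ((1 + \<xi>\<^sup>2) powr s * (cmod (g \<xi>))\<^sup>2))" using gs by simp
      fix \<xi> :: real
      show "indicator (annulus (2 ^ j)) \<xi> *\<^sub>R (cmod (g \<xi>))\<^sup>2 \<le> (2 ^ j) powr (- 2 * s) * ((1 + \<xi>\<^sup>2) powr s * (cmod (g \<xi>))\<^sup>2)"
      proof (cases "\<xi> \<in> annulus (2 ^ j)")
        case True
        have "1 = (2 ^ j) powr (- 2 * s) * ((2 ^ j)\<^sup>2) powr s"
          by (simp add: power2_eq_square powr_mult flip: powr_add)
        also have "\<dots> \<le> (2 ^ j) powr (- 2 * s) * (1 + \<xi>\<^sup>2) powr s"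
        proof -
          have "(2 ^ j)\<^sup>2 \<le> \<bar>\<xi>\<bar>\<^sup>2" using True by (intro power_mono) (auto simp: annulus_def)
          then show ?thesis using \<open>s > 0\<close> by (intro mult_left_mono powr_mono2) auto
        qed
        finally have "1 * (cmod (g \<xi>))\<^sup>2 \<le> ((2 ^ j) powr (- 2 * s) * (1 + \<xi>\<^sup>2) powr s) * (cmod (g \<xi>))\<^sup>2"
          by (rule mult_right_mono) simp
        then show ?thesis using True by (simp add: mult.assoc)
      qed simp
    qed simp
    also have "\<dots> = (2 ^ j) powr (- 2 * s) * W" by (simp add: W_def)
    finally show ?thesis .
  qed
  \<comment> \<open>The room left in the hypothesis on \<open>s\<close>; it becomes the decay rate
    \<open>2 powr (- \<epsilon>)\<close> of the series.\<close>
  define \<epsilon> where "\<epsilon> = s - (1/2 - m/4 + m * r / 4)"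
  have \<epsilon>: "\<epsilon> > 0" using s by (simp add: \<epsilon>_def)
  have *: "AE x in lborel. x \<in> {-real R..real R} \<longrightarrow> continuous_on P (\<lambda>p. \<Sum>j. piece m (shell j) g p x)" for R :: nat
  proof -
    define \<kappa> where "\<kappa> = block_const m M (real R)"
    have \<kappa>: "\<kappa> > 0" unfolding \<kappa>_def by (rule block_const_pos[OF m M0])
    \<comment> \<open>The first summand is the maximal estimate, the second comes from the net error
      \<open>\<eta> = (1/2) ^ j\<close>. Both are geometric in \<open>j\<close>.\<close>
    define b where "b j = sqrt (W * \<kappa> * K * (2 * real R)) * (2 powr (- \<epsilon>)) ^ j + 2 * real R * (1 / 2) ^ j" for j
    have "\<exists>Mj. Mj \<in> borel_measurable borel \<and> (\<forall>x. 0 \<le> Mj x) \<and>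
      (\<forall>x. \<forall>p\<in>P. cmod (piece m (shell (Suc j)) g p x) \<le> Mj x) \<and>
      (\<integral>\<^sup>+x\<in>{-real R..real R}. ennreal (Mj x) \<partial>lborel) \<le> ennreal (b j)" for j
    proof -
      define L where "L = (2::real) ^ j"
      have L: "L \<ge> 1" by (simp add: L_def)
      have "(LINT \<xi>:annulus L|lborel. (cmod (g \<xi>))\<^sup>2) * (\<kappa> * L powr (1 - m / 2)) * card (C j) * (2 * real R)
         \<le> (L powr (- 2 * s) * W) * (\<kappa> * L powr (1 - m / 2)) * (K * L powr (m * r / 2)) * (2 * real R)"
        using G[of j] C(3)[of j] \<kappa> W unfolding L_def
        by (intro mult_right_mono mult_mono) (auto intro!: mult_nonneg_nonneg)
      also have "\<dots> = (W * \<kappa> * K * (2 * real R)) * (L powr (- \<epsilon>))\<^sup>2"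
      proof -
        \<comment> \<open>Regularity, kernel size and covering number combine:
          \<open>- 2 * s + (1 - m / 2) + m * r / 2 = - 2 * \<epsilon>\<close>.\<close>
        have "L powr (- 2 * s) * L powr (1 - m / 2) * L powr (m * r / 2) = (L powr (- \<epsilon>))\<^sup>2"
          unfolding power2_eq_square powr_add[symmetric] by (simp add: \<epsilon>_def algebra_simps add_divide_distrib)
        then show ?thesis by (simp add: algebra_simps)
      qed
      finally have "sqrt ((LINT \<xi>:annulus L|lborel. (cmod (g \<xi>))\<^sup>2) * (\<kappa> * L powr (1 - m / 2)) * card (C j) * (2 * real R))
         \<le> sqrt (W * \<kappa> * K * (2 * real R)) * L powr (- \<epsilon>)"
        by (rule order_trans[OF real_sqrt_le_mono]) (simp add: real_sqrt_mult)
      moreover have "L powr (- \<epsilon>) = (2 powr (- \<epsilon>)) ^ j"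
        by (simp add: L_def powr_power flip: powr_realpow) (simp add: powr_powr mult.commute)
      ultimately have le: "ennreal (sqrt ((LINT \<xi>:annulus L|lborel. (cmod (g \<xi>))\<^sup>2) * (\<kappa> * L powr (1 - m / 2)) * card (C j) * (2 * real R)) + 2 * real R * (1 / 2) ^ j)
         \<le> ennreal (b j)"
        unfolding b_def by (intro ennreal_leI) simp
      have c: "\<Theta> \<subseteq> (\<Union>c\<in>C j. {c..c + L powr (- m / 2)})" using C(2)[of j] by (simp add: L_def)
      have i: "set_integrable lborel (annulus L) g" "set_integrable lborel (annulus L) (\<lambda>\<xi>. (cmod (g \<xi>))\<^sup>2)"
        using shell_integrable[OF g g2, of "Suc j"] by (simp_all add: annulus_shell L_def)
      obtain Mj where Mj: "Mj \<in> borel_measurable borel" "\<forall>x. 0 \<le> Mj x"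
        "\<forall>x. \<forall>p\<in>P. cmod (piece m (annulus L) g p x) \<le> Mj x"
        "(\<integral>\<^sup>+x\<in>{-real R..real R}. ennreal (Mj x) \<partial>lborel) \<le>
           ennreal (sqrt ((LINT \<xi>:annulus L|lborel. (cmod (g \<xi>))\<^sup>2) * (\<kappa> * L powr (1 - m / 2)) * card (C j) * (2 * real R)) + 2 * real R * (1 / 2) ^ j)"
        using dyadic_majorant[OF m L, of "real R" "(1/2) ^ j" \<Theta> M "C j" g, OF _ _ \<Theta> M C(1) c g i]
        unfolding P_def \<kappa>_def by auto
      then show ?thesis using order_trans[OF Mj(4) le]
        by (intro exI[of _ Mj]) (simp add: L_def annulus_shell)
    qed
    then obtain N where [measurable]: "\<And>j. N j \<in> borel_measurable borel" and N0: "\<And>j x. 0 \<le> N j x"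
      and N: "\<And>j x p. p \<in> P \<Longrightarrow> cmod (piece m (shell (Suc j)) g p x) \<le> N j x"
      and Nb: "\<And>j. (\<integral>\<^sup>+x\<in>{-real R..real R}. ennreal (N j x) \<partial>lborel) \<le> ennreal (b j)" by metis
    have b0: "0 \<le> b j" for j using W \<kappa> K by (simp add: b_def)
    have "summable b" unfolding b_def using \<epsilon>
      by (intro summable_add summable_mult summable_geometric) (auto simp: powr_less_one)
    have "(\<integral>\<^sup>+x. (\<Sum>j. ennreal (N j x) * indicator {-real R..real R} x) \<partial>lborel) = (\<Sum>j. \<integral>\<^sup>+x\<in>{-real R..real R}. ennreal (N j x) \<partial>lborel)"
      by (rule nn_integral_suminf) measurable
    also have "\<dots> \<le> (\<Sum>j. ennreal (b j))" by (intro suminf_le Nb) auto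
    also have "\<dots> < \<infinity>" using suminf_ennreal_eq[OF b0 summable_sums[OF \<open>summable b\<close>]] by simp
    finally have "AE x in lborel. (\<Sum>j. ennreal (N j x) * indicator {-real R..real R} x) \<noteq> \<infinity>"
      by (intro nn_integral_PInf_AE) auto
    then show ?thesis
    proof eventually_elim
      case (elim x)
      show ?case
      proof
        assume "x \<in> {-real R..real R}"
        then have "(\<Sum>j. ennreal (N j x)) \<noteq> \<infinity>" using elim by simp
        then have sN: "summable (\<lambda>j. N j x)" using N0 by (intro summable_suminf_not_top) auto
        \<comment> \<open>The majorants \<open>N\<close> start at shell 1; on shell 0 the integral
          of \<open>cmod (g \<xi>)\<close> is bound enough.\<close>
        define M' where "M' j = (case j of 0 \<Rightarrow> (LINT \<xi>:shell 0|lborel. cmod (g \<xi>)) | Suc i \<Rightarrow> N i x)" for j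
        have "summable M'" using sN by (subst summable_Suc_iff[symmetric]) (simp add: M'_def)
        have mu: "0 \<le> snd (snd p)" if "p \<in> P" for p using that by (auto simp: P_def)
        have "uniform_limit P (\<lambda>n p. \<Sum>j<n. piece m (shell j) g p x) (\<lambda>p. \<Sum>j. piece m (shell j) g p x) sequentially"
        proof (rule Weierstrass_m_test[OF _ \<open>summable M'\<close>])
          fix n p assume "p \<in> P"
          then show "norm (piece m (shell n) g p x) \<le> M' n"
            using N piece_bound[OF shell_measurable shell_integrable(1)[OF g g2] mu]
            by (cases n) (auto simp: M'_def)
        qed
        then show "continuous_on P (\<lambda>p. \<Sum>j. piece m (shell j) g p x)"
          by (rule uniform_limit_theorem[rotated])
             (auto intro!: always_eventually continuous_on_sum continuous_on_piece m cP mu shell_integrable g2)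
      qed
    qed
  qed
  then have "AE x in lborel. \<forall>R::nat. x \<in> {-real R..real R} \<longrightarrow> continuous_on P (\<lambda>p. \<Sum>j. piece m (shell j) g p x)"
    by (subst AE_all_countable) auto
  then show ?thesis
  proof eventually_elim
    case (elim x)
    obtain R :: nat where "\<bar>x\<bar> \<le> real R" using real_arch_simple by blast
    then show ?case using elim by (auto simp: abs_le_iff)
  qed
qed

section \<open>The Fourier transform and coverings\<close>

lemma complex_borel_version:
  fixes f :: "real \<Rightarrow> complex"
  assumes [measurable]: "f \<in> borel_measurable lebesgue"
  obtains f' where "f' \<in> borel_measurable borel" "AE x in lborel. f x = f' x"
proof -
  obtain u v :: "real \<Rightarrow> real" where [measurable]: "u \<in> borel_measurable borel" "v \<in> borel_measurable borel"
    and u: "AE x in lborel. Re (f x) = u x" and v: "AE x in lborel. Im (f x) = v x"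
    using completion_ex_borel_measurable_real[of "\<lambda>x. Re (f x)" lborel] completion_ex_borel_measurable_real[of "\<lambda>x. Im (f x)" lborel]
    by auto
  show ?thesis
  proof (rule that[of "\<lambda>x. Complex (u x) (v x)"])
    show "(\<lambda>x. Complex (u x) (v x)) \<in> borel_measurable borel" unfolding Complex_eq by measurable
    show "AE x in lborel. f x = Complex (u x) (v x)" using u v by eventually_elim (simp add: complex_eq_iff)
  qed
qed

lemma integral_lebesgue_AE_eq:
  fixes f f' :: "real \<Rightarrow> complex"
  assumes [measurable]: "f \<in> borel_measurable lebesgue" "f' \<in> borel_measurable borel"
    and "AE x in lborel. f x = f' x"
  shows "integral\<^sup>L lebesgue f = integral\<^sup>L lborel f'"
proof -
  have "integral\<^sup>L lebesgue f = integral\<^sup>L lebesgue f'"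
    by (rule integral_cong_AE) (use assms in \<open>auto intro: AE_completion measurable_completion\<close>)
  then show ?thesis by (simp add: integral_completion)
qed

text \<open>Both functions are limits in the mean square of the same truncated integrals. This makes
  the arbitrary choice in \<open>fourier\<close> agree almost everywhere with any transform supplied
  by \<open>sobolev\<close>.\<close>

lemma has_fourier_unique:
  assumes "has_fourier f g" "has_fourier f h"
  shows "AE \<xi> in lebesgue. g \<xi> = h \<xi>"
proof -
  have f [measurable]: "f \<in> borel_measurable lebesgue" and [measurable]: "g \<in> borel_measurable lebesgue" "h \<in> borel_measurable lebesgue"
    using assms by (auto simp: has_fourier_def L2_def)
  obtain f' where [measurable]: "f' \<in> borel_measurable borel" and f': "AE x in lborel. f x = f' x"
    by (rule complex_borel_version[OF f])
  define F where "F R \<xi> = (LINT x:{-R..R}|lebesgue. cis (- (x * \<xi>)) * f x)" for R \<xi>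
  \<comment> \<open>Passing to a Borel version of \<open>f\<close> makes measurability of the
    truncated integral in \<open>\<xi>\<close> available.\<close>
  have "F R \<xi> = (LINT x|lborel. indicator {-R..R} x *\<^sub>R (cis (- (x * \<xi>)) * f' x))" for R \<xi>
    unfolding F_def set_lebesgue_integral_def
  proof (rule integral_lebesgue_AE_eq)
    have cis: "(\<lambda>x. cis (- (x * \<xi>))) \<in> borel_measurable lebesgue"
      by (rule measurable_completion) measurable
    show "(\<lambda>x. indicat_real {- R..R} x *\<^sub>R (cis (- (x * \<xi>)) * f x)) \<in> borel_measurable lebesgue"
      by (intro borel_measurable_scaleR borel_measurable_indicator borel_measurable_times cis f) auto
    show "AE x in lborel. indicat_real {- R..R} x *\<^sub>R (cis (- (x * \<xi>)) * f x) = indicat_real {- R..R} x *\<^sub>R (cis (- (x * \<xi>)) * f' x)"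
      using f' by eventually_elim simp
  qed measurable
  then have "F R = (\<lambda>\<xi>. LINT x|lborel. indicator {-R..R} x *\<^sub>R (cis (- (x * \<xi>)) * f' x))" for R by (rule ext)
  then have "F R \<in> borel_measurable borel" for R by simp
  then have [measurable]: "F R \<in> borel_measurable lebesgue" for R by (intro measurable_completion) simp
  define a where "a R = (\<integral>\<^sup>+ \<xi>. ennreal ((cmod (g \<xi> - F R \<xi>))\<^sup>2) \<partial>lebesgue)" for R
  define b where "b R = (\<integral>\<^sup>+ \<xi>. ennreal ((cmod (h \<xi> - F R \<xi>))\<^sup>2) \<partial>lebesgue)" for R
  have ab: "(a \<longlongrightarrow> 0) at_top" "(b \<longlongrightarrow> 0) at_top"
    using assms by (auto simp: has_fourier_def a_def[abs_def] b_def[abs_def] F_def)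
  have le: "(\<integral>\<^sup>+ \<xi>. ennreal ((cmod (g \<xi> - h \<xi>))\<^sup>2) \<partial>lebesgue) \<le> 2 * a R + 2 * b R" for R
  proof -
    have "(cmod (g \<xi> - h \<xi>))\<^sup>2 \<le> 2 * (cmod (g \<xi> - F R \<xi>))\<^sup>2 + 2 * (cmod (h \<xi> - F R \<xi>))\<^sup>2" for \<xi>
    proof -
      have "(cmod (g \<xi> - h \<xi>))\<^sup>2 \<le> (cmod (g \<xi> - F R \<xi>) + cmod (h \<xi> - F R \<xi>))\<^sup>2"
        using norm_triangle_ineq4[of "g \<xi> - F R \<xi>" "h \<xi> - F R \<xi>"] by (intro power_mono) auto
      also have "\<dots> \<le> 2 * (cmod (g \<xi> - F R \<xi>))\<^sup>2 + 2 * (cmod (h \<xi> - F R \<xi>))\<^sup>2"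
        using sum_squares_bound[of "cmod (g \<xi> - F R \<xi>)" "cmod (h \<xi> - F R \<xi>)"] by (simp add: power2_sum)
      finally show ?thesis .
    qed
    then have "ennreal ((cmod (g \<xi> - h \<xi>))\<^sup>2) \<le> ennreal (2 * (cmod (g \<xi> - F R \<xi>))\<^sup>2 + 2 * (cmod (h \<xi> - F R \<xi>))\<^sup>2)" for \<xi>
      by (rule ennreal_leI)
    then have "(\<integral>\<^sup>+ \<xi>. ennreal ((cmod (g \<xi> - h \<xi>))\<^sup>2) \<partial>lebesgue)
      \<le> (\<integral>\<^sup>+ \<xi>. 2 * ennreal ((cmod (g \<xi> - F R \<xi>))\<^sup>2) + 2 * ennreal ((cmod (h \<xi> - F R \<xi>))\<^sup>2) \<partial>lebesgue)"
      by (intro nn_integral_mono) (simp add: ennreal_plus ennreal_mult')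
    also have "\<dots> = 2 * a R + 2 * b R"
      by (simp add: a_def b_def nn_integral_add nn_integral_cmult)
    finally show ?thesis .
  qed
  have "((\<lambda>R. 2 * a R + 2 * b R) \<longlongrightarrow> 2 * 0 + 2 * 0) at_top"
    by (intro tendsto_add ennreal_tendsto_cmult ab) auto
  then have "((\<lambda>R. 2 * a R + 2 * b R) \<longlongrightarrow> 0) at_top" by simp
  then have "(\<integral>\<^sup>+ \<xi>. ennreal ((cmod (g \<xi> - h \<xi>))\<^sup>2) \<partial>lebesgue) \<le> 0"
    by (rule tendsto_lowerbound) (use le in auto)
  then have "AE \<xi> in lebesgue. ennreal ((cmod (g \<xi> - h \<xi>))\<^sup>2) = 0"
    by (subst nn_integral_0_iff_AE[symmetric]) auto
  then show ?thesis by eventually_elim simp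
qed

text \<open>The bounds hold for the witness in \<open>sobolev\<close> and pass to
  \<open>fourier f\<close> by uniqueness; a Borel version \<open>g\<close> then replaces it in all
  later estimates. The weight appears squared, which turns \<open>s / 2\<close> into
  \<open>s\<close>.\<close>

lemma sobolev_fourier:
  assumes f: "f \<in> sobolev s"
  obtains g where "g \<in> borel_measurable borel" "AE \<xi> in lborel. fourier f \<xi> = g \<xi>" "fourier f \<in> borel_measurable lebesgue"
    "integrable lborel (\<lambda>\<xi>. (cmod (g \<xi>))\<^sup>2)" "integrable lborel (\<lambda>\<xi>. (1 + \<xi>\<^sup>2) powr s * (cmod (g \<xi>))\<^sup>2)"
proof -
  obtain g0 h where g0: "has_fourier f g0" and h: "has_fourier h (\<lambda>\<xi>. of_real ((1 + \<xi>\<^sup>2) powr (s / 2)) * g0 \<xi>)"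
    using f by (auto simp: sobolev_def)
  have ff: "has_fourier f (fourier f)" unfolding fourier_def by (rule someI[of "has_fourier f", OF g0])
  have [measurable]: "fourier f \<in> borel_measurable lebesgue" "g0 \<in> borel_measurable lebesgue"
    using ff g0 by (auto simp: has_fourier_def L2_def)
  obtain g where g [measurable]: "g \<in> borel_measurable borel" and fg: "AE \<xi> in lborel. fourier f \<xi> = g \<xi>"
    by (rule complex_borel_version[of "fourier f"]) auto
  have gm [measurable]: "g \<in> borel_measurable lebesgue" using g by (intro measurable_completion) simp
  have eq: "AE \<xi> in lebesgue. g0 \<xi> = g \<xi>"
    using has_fourier_unique[OF g0 ff] AE_completion[OF fg] by eventually_elim simp
  have "integrable lebesgue (\<lambda>\<xi>. (cmod (g0 \<xi>))\<^sup>2)" using g0 by (auto simp: has_fourier_def L2_def)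
  then have "integrable lebesgue (\<lambda>\<xi>. (cmod (g \<xi>))\<^sup>2)"
    by (rule integrable_cong_AE_imp) (use eq in \<open>auto elim!: eventually_mono\<close>)
  then have 1: "integrable lborel (\<lambda>\<xi>. (cmod (g \<xi>))\<^sup>2)" by (subst (asm) integrable_completion) auto
  have wm [measurable]: "(\<lambda>\<xi>::real. (1 + \<xi>\<^sup>2) powr s) \<in> borel_measurable lebesgue"
    by (rule measurable_completion) measurable
  have "integrable lebesgue (\<lambda>\<xi>. (cmod (of_real ((1 + \<xi>\<^sup>2) powr (s / 2)) * g0 \<xi>))\<^sup>2)"
    using h by (auto simp: has_fourier_def L2_def)
  also have "(\<lambda>\<xi>. (cmod (of_real ((1 + \<xi>\<^sup>2) powr (s / 2)) * g0 \<xi>))\<^sup>2) = (\<lambda>\<xi>. (1 + \<xi>\<^sup>2) powr s * (cmod (g0 \<xi>))\<^sup>2)"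
  proof
    fix \<xi> :: real
    have "((1 + \<xi>\<^sup>2) powr (s / 2))\<^sup>2 = (1 + \<xi>\<^sup>2) powr s"
      unfolding power2_eq_square[of "(1 + \<xi>\<^sup>2) powr (s / 2)"] powr_add[symmetric] by simp
    then show "(cmod (of_real ((1 + \<xi>\<^sup>2) powr (s / 2)) * g0 \<xi>))\<^sup>2 = (1 + \<xi>\<^sup>2) powr s * (cmod (g0 \<xi>))\<^sup>2"
      by (simp add: norm_mult power_mult_distrib)
  qed
  finally have "integrable lebesgue (\<lambda>\<xi>. (1 + \<xi>\<^sup>2) powr s * (cmod (g0 \<xi>))\<^sup>2)" .
  then have "integrable lebesgue (\<lambda>\<xi>. (1 + \<xi>\<^sup>2) powr s * (cmod (g \<xi>))\<^sup>2)"
    by (rule integrable_cong_AE_imp) (use eq in \<open>auto elim!: eventually_mono\<close>)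
  then have 2: "integrable lborel (\<lambda>\<xi>. (1 + \<xi>\<^sup>2) powr s * (cmod (g \<xi>))\<^sup>2)" by (subst (asm) integrable_completion) auto
  show ?thesis by (rule that[OF g fg _ 1 2]) measurable
qed

section \<open>Minkowski dimension and dyadic coverings\<close>

lemma covering_number_bound:
  assumes M: "\<Theta> \<subseteq> {-M..M}" "0 \<le> M" and \<delta>: "0 < \<delta>"
  shows "\<exists>C. finite C \<and> card C = covering_number \<Theta> \<delta> \<and> \<Theta> \<subseteq> (\<Union>c\<in>C. {c..c + \<delta>})"
    and "real (covering_number \<Theta> \<delta>) \<le> 2 * M / \<delta> + 1"
proof -
  define K where "K = nat \<lfloor>2 * M / \<delta>\<rfloor>"
  \<comment> \<open>A grid of step \<open>\<delta>\<close> starting at \<open>- M\<close>, whose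
    last interval reaches past \<open>M\<close>.\<close>
  define C where "C = (\<lambda>k. - M + real k * \<delta>) ` {..K}"
  have cov: "\<Theta> \<subseteq> (\<Union>c\<in>C. {c..c + \<delta>})"
  proof
    fix \<theta> assume "\<theta> \<in> \<Theta>"
    then have \<theta>: "- M \<le> \<theta>" "\<theta> \<le> M" using M by auto
    define k where "k = nat \<lfloor>(\<theta> + M) / \<delta>\<rfloor>"
    have nn: "0 \<le> (\<theta> + M) / \<delta>" using \<theta> \<delta> by simp
    have "(\<theta> + M) / \<delta> \<le> 2 * M / \<delta>" using \<theta> \<delta> by (intro divide_right_mono) auto
    then have "k \<le> K" unfolding k_def K_def by (intro nat_mono floor_mono)
    moreover have "real k \<le> (\<theta> + M) / \<delta>" "(\<theta> + M) / \<delta> \<le> real k + 1" using nn by (auto simp: k_def)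
    then have "real k * \<delta> \<le> \<theta> + M" "\<theta> + M \<le> (real k + 1) * \<delta>" using \<delta> by (simp_all add: field_simps)
    then have "\<theta> \<in> {- M + real k * \<delta>..- M + real k * \<delta> + \<delta>}" by (simp add: algebra_simps)
    ultimately show "\<theta> \<in> (\<Union>c\<in>C. {c..c + \<delta>})" unfolding C_def by blast
  qed
  \<comment> \<open>Some finite cover exists, so the least cardinality in
    \<open>covering_number\<close> is attained.\<close>
  have ex: "\<exists>C'. finite C' \<and> card C' = card C \<and> \<Theta> \<subseteq> (\<Union>c\<in>C'. {c..c + \<delta>})"
    using cov by (intro exI[of _ C]) (auto simp: C_def)
  show "\<exists>C. finite C \<and> card C = covering_number \<Theta> \<delta> \<and> \<Theta> \<subseteq> (\<Union>c\<in>C. {c..c + \<delta>})"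
    unfolding covering_number_def by (rule LeastI_ex) (use ex in blast)
  have "covering_number \<Theta> \<delta> \<le> card C" unfolding covering_number_def by (rule Least_le) (rule ex)
  also have "card C \<le> K + 1" unfolding C_def using card_image_le[of "{..K}"] by simp
  finally have "real (covering_number \<Theta> \<delta>) \<le> real K + 1" by linarith
  also have "real K \<le> 2 * M / \<delta>" using M \<delta> by (simp add: K_def)
  finally show "real (covering_number \<Theta> \<delta>) \<le> 2 * M / \<delta> + 1" by simp
qed

text \<open>The exponent 2 is always admissible for a bounded set, by the linear growth of covering
  numbers in \<open>1 / \<delta>\<close>. The infimum is thus over a nonempty set, and some
  admissible exponent lies below \<open>z\<close>.\<close>

lemma minkowski_dim_lessD:
  assumes \<Theta>: "bounded \<Theta>" and z: "minkowski_dim \<Theta> < z"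
  obtains r where "0 < r" "r < z" "((\<lambda>\<delta>. real (covering_number \<Theta> \<delta>) * \<delta> powr r) \<longlongrightarrow> 0) (at_right 0)"
proof -
  obtain M where "\<And>\<theta>. \<theta> \<in> \<Theta> \<Longrightarrow> \<bar>\<theta>\<bar> \<le> M" using \<Theta> unfolding bounded_iff real_norm_def by metis
  then have M: "\<Theta> \<subseteq> {-\<bar>M\<bar>..\<bar>M\<bar>}" by force
  have "((\<lambda>\<delta>. real (covering_number \<Theta> \<delta>) * \<delta> powr 2) \<longlongrightarrow> 0) (at_right 0)"
  proof (rule tendsto_sandwich[where f="\<lambda>_. 0" and h="\<lambda>\<delta>. 2 * \<bar>M\<bar> * \<delta> + \<delta>\<^sup>2"])
    show "\<forall>\<^sub>F \<delta> in at_right 0. real (covering_number \<Theta> \<delta>) * \<delta> powr 2 \<le> 2 * \<bar>M\<bar> * \<delta> + \<delta>\<^sup>2"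
      using eventually_at_right_less[of 0]
    proof eventually_elim
      case (elim \<delta>)
      then have "real (covering_number \<Theta> \<delta>) * \<delta>\<^sup>2 \<le> (2 * \<bar>M\<bar> / \<delta> + 1) * \<delta>\<^sup>2"
        using covering_number_bound(2)[OF M _ elim] by (intro mult_right_mono) auto
      also have "(2 * \<bar>M\<bar> / \<delta> + 1) * \<delta>\<^sup>2 = 2 * \<bar>M\<bar> * \<delta> + \<delta>\<^sup>2"
        using elim by (simp add: field_simps power2_eq_square)
      finally show ?case using elim by simp
    qed
    show "((\<lambda>\<delta>. 2 * \<bar>M\<bar> * \<delta> + \<delta>\<^sup>2) \<longlongrightarrow> 0) (at_right 0)"
      by (rule tendsto_eq_intros refl | simp)+
  qed (auto intro!: always_eventually)
  then have "{r. 0 < r \<and> ((\<lambda>\<delta>. real (covering_number \<Theta> \<delta>) * \<delta> powr r) \<longlongrightarrow> 0) (at_right 0)} \<noteq> {}"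
    by (intro ex_in_conv[THEN iffD1] exI[of _ 2]) simp
  from cInf_lessD[OF this z[unfolded minkowski_dim_def]] show ?thesis using that by auto
qed

text \<open>Along the scales \<open>\<delta> j\<close> the convergent quantity is bounded by some
  \<open>K\<close>, and \<open>\<delta> j powr (- r)\<close> is
  \<open>(2 ^ j) powr (m * r / 2)\<close>. The point 0 costs one more interval, absorbed by
  \<open>K + 1\<close> since \<open>q \<ge> 1\<close>.\<close>

lemma dyadic_covers:
  assumes \<Theta>: "bounded \<Theta>" and m: "0 < m"
    and lim: "((\<lambda>\<delta>. real (covering_number \<Theta> \<delta>) * \<delta> powr r) \<longlongrightarrow> 0) (at_right 0)" and r: "0 \<le> r"
  obtains K where "\<And>j::nat. \<exists>C. finite C \<and> insert 0 \<Theta> \<subseteq> (\<Union>c\<in>C. {c..c + (2 ^ j) powr (- m / 2)})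
    \<and> real (card C) \<le> K * (2 ^ j) powr (m * r / 2)"
proof -
  obtain M where "\<And>\<theta>. \<theta> \<in> \<Theta> \<Longrightarrow> \<bar>\<theta>\<bar> \<le> M" using \<Theta> unfolding bounded_iff real_norm_def by metis
  then have M: "\<Theta> \<subseteq> {-\<bar>M\<bar>..\<bar>M\<bar>}" by force
  define \<delta> where "\<delta> j = (2 ^ j) powr (- m / 2)" for j :: nat
  have pos: "\<delta> j > 0" for j by (simp add: \<delta>_def)
  have "\<delta> j = (2 powr (- m / 2)) ^ j" for j
    by (simp add: \<delta>_def powr_power flip: powr_realpow) (simp add: powr_powr mult.commute)
  moreover have "(\<lambda>j. (2 powr (- m / 2)) ^ j) \<longlonglongrightarrow> 0"
    using m by (intro LIMSEQ_realpow_zero) (auto simp: powr_less_one)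
  ultimately have "\<delta> \<longlonglongrightarrow> 0" by (simp add: \<delta>_def[abs_def])
  then have "filterlim \<delta> (at_right 0) sequentially"
    using pos by (intro tendsto_imp_filterlim_at_right always_eventually) auto
  from filterlim_compose[OF lim this]
  have "Bseq (\<lambda>j. real (covering_number \<Theta> (\<delta> j)) * \<delta> j powr r)"
    by (intro convergent_imp_Bseq) (auto simp: convergent_def)
  then obtain K where K: "\<And>j. \<bar>real (covering_number \<Theta> (\<delta> j)) * \<delta> j powr r\<bar> \<le> K"
    unfolding Bseq_def real_norm_def by metis
  show ?thesis
  proof (rule that[of "K + 1"])
    fix j :: nat
    obtain C where C: "finite C" "card C = covering_number \<Theta> (\<delta> j)" "\<Theta> \<subseteq> (\<Union>c\<in>C. {c..c + \<delta> j})"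
      using covering_number_bound(1)[OF M abs_ge_zero pos[of j]] by auto
    define q where "q = (2 ^ j) powr (m * r / 2)"
    have q: "q \<ge> 1" unfolding q_def using m r by (intro ge_one_powr_ge_zero) auto
    have "\<delta> j powr r * q = 1"
      by (simp add: \<delta>_def q_def powr_powr flip: powr_add)
    then have "real (card C) = (real (covering_number \<Theta> (\<delta> j)) * \<delta> j powr r) * q" by (simp add: C mult.assoc)
    also have "\<dots> \<le> K * q" using K[of j] q by (intro mult_right_mono) auto
    finally have "real (card (insert 0 C)) \<le> (K + 1) * q"
      using q card_insert_le_m1[of "card C + 1" C 0] by (simp add: algebra_simps)
    moreover have "insert 0 \<Theta> \<subseteq> (\<Union>c\<in>insert 0 C. {c..c + \<delta> j})" using C(3) pos[of j] by (auto simp: less_imp_le)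
    moreover have "finite (insert 0 C)" using C(1) by simp
    ultimately show "\<exists>C. finite C \<and> insert 0 \<Theta> \<subseteq> (\<Union>c\<in>C. {c..c + (2 ^ j) powr (- m / 2)})
      \<and> real (card C) \<le> (K + 1) * (2 ^ j) powr (m * r / 2)"
      unfolding \<delta>_def q_def by (intro exI[of _ "insert 0 C"] conjI)
  qed
qed

text \<open>The shift of the base point becomes the phase \<open>- \<theta> * t * \<xi>\<close>
  inside \<open>symbol\<close>, so \<open>x\<close> stays fixed while only the parameter
  moves.\<close>

lemma propagator_mean_eq:
  assumes [measurable]: "g \<in> borel_measurable borel" "fourier f \<in> borel_measurable lebesgue"
    and fg: "AE \<xi> in lborel. fourier f \<xi> = g \<xi>"
  shows "propagator_mean m f (x - \<theta> * t) t N =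
    of_real (1 / (2 * pi)) * (LINT \<xi>|lborel. cis (x * \<xi>) * symbol m (\<theta>, t, 1 / N\<^sup>2) \<xi> * g \<xi>)"
proof -
  define k where "k \<xi> = cis ((x - \<theta> * t) * \<xi> + t * \<bar>\<xi>\<bar> powr m) * of_real (exp (- (\<bar>\<xi>\<bar>\<^sup>2 / N\<^sup>2)))" for \<xi>
  have k: "k \<xi> = cis (x * \<xi>) * symbol m (\<theta>, t, 1 / N\<^sup>2) \<xi>" for \<xi>
  proof -
    have "cis (x * \<xi>) * cis (t * \<bar>\<xi>\<bar> powr m - \<theta> * t * \<xi>) = cis ((x - \<theta> * t) * \<xi> + t * \<bar>\<xi>\<bar> powr m)"
      by (simp add: cis_mult algebra_simps)
    then show ?thesis by (simp add: k_def symbol_def)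
  qed
  have km: "k \<in> borel_measurable borel" unfolding k_def by measurable
  then have [measurable]: "k \<in> borel_measurable lebesgue" by (intro measurable_completion) simp
  have "(LINT \<xi>|lebesgue. k \<xi> * fourier f \<xi>) = (LINT \<xi>|lborel. k \<xi> * g \<xi>)"
    by (rule integral_lebesgue_AE_eq) (use fg km in \<open>auto elim!: eventually_mono\<close>)
  then show ?thesis unfolding propagator_mean_def k_def[symmetric] k by simp
qed

section \<open>Passage to the limit in the parameters\<close>

theorem theorem3:
  fixes m s :: real and \<Theta> :: "real set"
  assumes "0 < m" and "m < 1"
    and "compact \<Theta>"
    and "0 \<le> minkowski_dim \<Theta>" and "minkowski_dim \<Theta> \<le> 1"
    and "s > 1/2 - m/4 + m * minkowski_dim \<Theta> / 4"
  shows "\<forall>f \<in> sobolev s. AE x in lebesgue.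
    propagator_defined m f x 0 \<and>
    (\<forall>\<^sub>F t in at 0. \<forall>\<theta>\<in>\<Theta>. propagator_defined m f (x - \<theta> * t) t) \<and>
    uniform_limit \<Theta> (\<lambda>t \<theta>. propagator m f (x - \<theta> * t) t) (\<lambda>\<theta>. propagator m f x 0) (at 0)"
proof
  fix f assume f: "f \<in> sobolev s"
  obtain g where g [measurable]: "g \<in> borel_measurable borel" "fourier f \<in> borel_measurable lebesgue"
    and fg: "AE \<xi> in lborel. fourier f \<xi> = g \<xi>"
    and g2: "integrable lborel (\<lambda>\<xi>. (cmod (g \<xi>))\<^sup>2)" and gs: "integrable lborel (\<lambda>\<xi>. (1 + \<xi>\<^sup>2) powr s * (cmod (g \<xi>))\<^sup>2)"
    by (rule sobolev_fourier[OF f])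
  \<comment> \<open>The hypothesis on \<open>s\<close> solved for the dimension; being strict, it
    leaves room for an admissible exponent \<open>r\<close> that satisfies the same
    inequality.\<close>
  have "minkowski_dim \<Theta> < (s - 1/2 + m/4) * 4 / m" using assms by (simp add: field_simps)
  then obtain r where r: "0 < r" "r < (s - 1/2 + m/4) * 4 / m"
    "((\<lambda>\<delta>. real (covering_number \<Theta> \<delta>) * \<delta> powr r) \<longlongrightarrow> 0) (at_right 0)"
    by (rule minkowski_dim_lessD[OF compact_imp_bounded[OF assms(3)]])
  have s: "s > 1/2 - m/4 + m * r / 4" using r(2) assms(1) by (simp add: field_simps)
  \<comment> \<open>Adding 0 makes the set nonempty and provides the parameter
    \<open>(0, 0, 0)\<close> for the value at time 0.\<close>
  define \<Theta>' where "\<Theta>' = insert 0 \<Theta>"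
  define P where "P = \<Theta>' \<times> {-1..1::real} \<times> {0..1::real}"
  have cP: "compact P" unfolding P_def \<Theta>'_def by (intro compact_Times compact_insert assms(3) compact_Icc)
  obtain K where K: "\<And>j::nat. \<exists>C. finite C \<and> \<Theta>' \<subseteq> (\<Union>c\<in>C. {c..c + (2 ^ j) powr (- m / 2)})
    \<and> real (card C) \<le> K * (2 ^ j) powr (m * r / 2)"
    using dyadic_covers[OF compact_imp_bounded[OF assms(3)] assms(1) r(3)] r(1) unfolding \<Theta>'_def by auto
  have "AE x in lborel. continuous_on P (\<lambda>p. \<Sum>j. piece m (shell j) g p x)"
    unfolding P_def
    by (rule evolution_sum_continuous_AE[OF assms(1,2) _ s _ _ K g(1) gs g2])
       (use r(1) assms(3) in \<open>auto simp: \<Theta>'_def\<close>)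
  then have "AE x in lborel. propagator_defined m f x 0 \<and>
    (\<forall>\<^sub>F t in at 0. \<forall>\<theta>\<in>\<Theta>. propagator_defined m f (x - \<theta> * t) t) \<and>
    uniform_limit \<Theta> (\<lambda>t \<theta>. propagator m f (x - \<theta> * t) t) (\<lambda>\<theta>. propagator m f x 0) (at 0)"
  proof eventually_elim
    case (elim x)
    define H where "H p = of_real (1 / (2 * pi)) * (\<Sum>j. piece m (shell j) g p x)" for p
    have H: "continuous_on P H" unfolding H_def[abs_def] by (intro continuous_intros elim)
    \<comment> \<open>The regularised means are the values of \<open>H\<close> at damping
      \<open>1 / N\<^sup>2\<close>, so the limit in \<open>N\<close> is continuity of
      \<open>H\<close> at damping 0.\<close>
    have lim: "(propagator_mean m f (x - \<theta> * t) t \<longlongrightarrow> H (\<theta>, t, 0)) at_top"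
      if \<theta>: "\<theta> \<in> \<Theta>'" and t: "\<bar>t\<bar> \<le> 1" for \<theta> t
    proof -
      have N: "\<forall>\<^sub>F N :: real in at_top. N \<ge> 1" by (rule eventually_ge_at_top)
      have 0: "((\<lambda>N::real. 1 / N\<^sup>2) \<longlongrightarrow> 0) at_top"
        by (intro tendsto_divide_0[OF tendsto_const] filterlim_at_top_imp_at_infinity filterlim_pow_at_top filterlim_ident) simp
      have "((\<lambda>N. H (\<theta>, t, 1 / N\<^sup>2)) \<longlongrightarrow> H (\<theta>, t, 0)) at_top"
      proof (rule continuous_on_tendsto_compose[OF H])
        show "((\<lambda>N::real. (\<theta>, t, 1 / N\<^sup>2)) \<longlongrightarrow> (\<theta>, t, 0)) at_top" by (intro tendsto_Pair tendsto_const 0)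
        show "(\<theta>, t, 0) \<in> P" using \<theta> t by (auto simp: P_def abs_le_iff)
        show "\<forall>\<^sub>F N in at_top. (\<theta>, t, 1 / N\<^sup>2) \<in> P"
          using N by eventually_elim (use \<theta> t in \<open>auto simp: P_def abs_le_iff\<close>)
      qed
      \<comment> \<open>For \<open>N \<ge> 1\<close> the damping is strictly positive, so the
        integral may be split into shells.\<close>
      moreover have "\<forall>\<^sub>F N in at_top. H (\<theta>, t, 1 / N\<^sup>2) = propagator_mean m f (x - \<theta> * t) t N"
        using N
      proof eventually_elim
        case (elim N)
        then show ?case
          unfolding propagator_mean_eq[OF g fg] H_def by (subst piece_shell_suminf[OF g(1) g2]) auto
      qed
      ultimately show ?thesis by (rule Lim_transform_eventually)
    qed
    have val: "propagator m f (x - \<theta> * t) t = H (\<theta>, t, 0)" if "\<theta> \<in> \<Theta>'" "\<bar>t\<bar> \<le> 1" for \<theta> t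
      unfolding propagator_def by (rule tendsto_Lim[OF _ lim[OF that]]) simp
    have small: "\<forall>\<^sub>F t :: real in at 0. \<bar>t\<bar> < d" if "d > 0" for d
      using that by (auto simp: eventually_at dist_norm intro!: exI[of _ d])
    show ?case
    proof (intro conjI)
      show "propagator_defined m f x 0"
        unfolding propagator_defined_def using lim[of 0 0] by (auto simp: \<Theta>'_def)
      show "\<forall>\<^sub>F t in at 0. \<forall>\<theta>\<in>\<Theta>. propagator_defined m f (x - \<theta> * t) t"
        using small[of 1, OF zero_less_one]
      proof eventually_elim
        case (elim t)
        then show ?case
          unfolding propagator_defined_def \<Theta>'_def using lim[of _ t] by (auto simp: \<Theta>'_def)
      qed
      show "uniform_limit \<Theta> (\<lambda>t \<theta>. propagator m f (x - \<theta> * t) t) (\<lambda>\<theta>. propagator m f x 0) (at 0)"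
      proof (rule uniform_limitI)
        fix e :: real assume "e > 0"
        then obtain d where d: "d > 0" and close: "\<And>p q. p \<in> P \<Longrightarrow> q \<in> P \<Longrightarrow> dist q p < d \<Longrightarrow> dist (H q) (H p) < e"
          using compact_uniformly_continuous[OF H cP] unfolding uniformly_continuous_on_def by metis
        have "\<forall>\<^sub>F t :: real in at 0. \<bar>t\<bar> < min 1 d" by (rule small) (use d in simp)
        then show "\<forall>\<^sub>F t in at 0. \<forall>\<theta>\<in>\<Theta>. dist (propagator m f (x - \<theta> * t) t) (propagator m f x 0) < e"
        proof eventually_elim
          case (elim t)
          show ?case
          proof
            fix \<theta> assume \<theta>: "\<theta> \<in> \<Theta>"
            \<comment> \<open>At time 0 the direction drops out of the symbol. The values at
              \<open>t\<close> and at 0 can therefore be compared along the same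
              \<open>\<theta>\<close>, at parameter distance \<open>\<bar>t\<bar>\<close>.\<close>
            have "H (\<theta>, 0, 0) = H (0, 0, 0)" by (simp add: H_def piece_def symbol_def)
            moreover have "dist (H (\<theta>, t, 0)) (H (\<theta>, 0, 0)) < e"
              by (rule close) (use \<theta> elim in \<open>auto simp: P_def \<Theta>'_def dist_Pair_Pair abs_le_iff\<close>)
            ultimately show "dist (propagator m f (x - \<theta> * t) t) (propagator m f x 0) < e"
              using val[of \<theta> t] val[of 0 0] \<theta> elim by (simp add: \<Theta>'_def)
          qed
        qed
      qed
    qed
  qed
  then show "AE x in lebesgue. propagator_defined m f x 0 \<and>
    (\<forall>\<^sub>F t in at 0. \<forall>\<theta>\<in>\<Theta>. propagator_defined m f (x - \<theta> * t) t) \<and>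
    uniform_limit \<Theta> (\<lambda>t \<theta>. propagator m f (x - \<theta> * t) t) (\<lambda>\<theta>. propagator m f x 0) (at 0)"
    by (rule AE_completion)
qed

end
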